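(* There exists a Polish group which has ample generics and countable cofinality; for example, $\mathrm{Iso}(X_{\mathbb{Q}^{>0}})$ is such a group.
   Context: For a countable $R\subseteq \mathbb{R}^{>0}$, the Polish ultrametric Urysohn space is $$X_R=\{x\in\mathbb{N}^R: \text{for every } r>0 \text{ the set } \{r'\in R: r'>r,\ x(r')\neq 0\}\text{ is finite}\},$$ with the ultrametric $d(x,y)=\max\{r\in R: x(r)\neq y(r)\}$ for $x\ne y$. $\mathrm{Iso}(X)$ is the group of all distance-preserving bijections of $X$ with the topology of pointwise convergence; it is a Polish group when $X$ is a Polish (separable complete) metric space. A Polish group $G$ has ample generics if for every $n\in\mathbb{N}$ (including $n=0$) the diagonal conjugation action of $G$ on $G^{n+1}$, $g.(g_0,\ldots,g_n)=(gg_0g^{-1},\ldots,gg_ng^{-1})$, has a comeager orbit. A group has countable cofinality if it is the union of a countably infinite, strictly increasing sequence of its subgroups. *)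

theory Defs
  imports "HOL-Analysis.Analysis" "HOL-Algebra.Bij"
begin

definition nowhere_dense_in :: "'a topology \<Rightarrow> 'a set \<Rightarrow> bool" where
  "nowhere_dense_in X A \<longleftrightarrow> A \<subseteq> topspace X \<and> X interior_of (X closure_of A) = {}"

definition meager_in :: "'a topology \<Rightarrow> 'a set \<Rightarrow> bool" where
  "meager_in X A \<longleftrightarrow>
     (\<exists>\<N>. countable \<N> \<and> (\<forall>N\<in>\<N>. nowhere_dense_in X N) \<and> A = \<Union>\<N>)"

definition comeager_in :: "'a topology \<Rightarrow> 'a set \<Rightarrow> bool" where
  "comeager_in X A \<longleftrightarrow> A \<subseteq> topspace X \<and> meager_in X (topspace X - A)"

definition topological_group :: "('a, 'b) monoid_scheme \<Rightarrow> 'a topology \<Rightarrow> bool" where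
  "topological_group G T \<longleftrightarrow>
     group G \<and> topspace T = carrier G \<and>
     continuous_map (prod_topology T T) T (\<lambda>(x, y). x \<otimes>\<^bsub>G\<^esub> y) \<and>
     continuous_map T T (\<lambda>x. inv\<^bsub>G\<^esub> x)"

definition polish_group :: "('a, 'b) monoid_scheme \<Rightarrow> 'a topology \<Rightarrow> bool" where
  "polish_group G T \<longleftrightarrow>
     topological_group G T \<and> completely_metrizable_space T \<and> separable_space T"

text \<open>
  A tuple \<open>(g\<^sub>0, \<dots>, g\<^sub>n)\<close> of \<open>G\<^sup>n\<^sup>+\<^sup>1\<close> is an element of \<open>{..n} \<rightarrow>\<^sub>E carrier G\<close>, which is the
  underlying set of the product topology indexed by \<open>{..n}\<close>.
\<close>

definition conj_orbit :: "('a, 'b) monoid_scheme \<Rightarrow> nat \<Rightarrow> (nat \<Rightarrow> 'a) \<Rightarrow> (nat \<Rightarrow> 'a) set" where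
  "conj_orbit G n x =
     (\<lambda>g. \<lambda>i\<in>{..n}. g \<otimes>\<^bsub>G\<^esub> x i \<otimes>\<^bsub>G\<^esub> inv\<^bsub>G\<^esub> g) ` carrier G"

definition ample_generics :: "('a, 'b) monoid_scheme \<Rightarrow> 'a topology \<Rightarrow> bool" where
  "ample_generics G T \<longleftrightarrow>
     (\<forall>n::nat. \<exists>x \<in> {..n} \<rightarrow>\<^sub>E carrier G.
        comeager_in (product_topology (\<lambda>_. T) {..n}) (conj_orbit G n x))"

definition countable_cofinality :: "('a, 'b) monoid_scheme \<Rightarrow> bool" where
  "countable_cofinality G \<longleftrightarrow>
     (\<exists>H :: nat \<Rightarrow> 'a set. (\<forall>n. subgroup (H n) G) \<and> strict_mono H \<and> (\<Union>n. H n) = carrier G)"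

definition Iso :: "'a set \<Rightarrow> ('a \<Rightarrow> 'a \<Rightarrow> real) \<Rightarrow> ('a \<Rightarrow> 'a) monoid" where
  "Iso M d = (BijGroup M)\<lparr>carrier := {f \<in> Bij M. \<forall>x\<in>M. \<forall>y\<in>M. d (f x) (f y) = d x y}\<rparr>"

definition Iso_topology :: "'a set \<Rightarrow> ('a \<Rightarrow> 'a \<Rightarrow> real) \<Rightarrow> ('a \<Rightarrow> 'a) topology" where
  "Iso_topology M d =
     subtopology (product_topology (\<lambda>_. Metric_space.mtopology M d) M) (carrier (Iso M d))"

definition urysohn :: "real set \<Rightarrow> (real \<Rightarrow> nat) set" where
  "urysohn R = {x \<in> R \<rightarrow>\<^sub>E UNIV. \<forall>r>0. finite {r' \<in> R. r' > r \<and> x r' \<noteq> 0}}"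

text \<open>
  The set of coordinates where two distinct points differ may be infinite, so \<^const>\<open>Max\<close> does not
  apply, although the set does have a greatest element.  Off \<^term>\<open>urysohn R\<close> the distance is 0
  because \<^locale>\<open>Metric_space\<close> asks for nonnegativity on the whole type.
\<close>

definition urysohn_dist :: "real set \<Rightarrow> (real \<Rightarrow> nat) \<Rightarrow> (real \<Rightarrow> nat) \<Rightarrow> real" where
  "urysohn_dist R x y =
     (if x \<in> urysohn R \<and> y \<in> urysohn R \<and> x \<noteq> y
      then (GREATEST r. r \<in> R \<and> x r \<noteq> y r) else 0)"

lemma urysohn_dist_eqI:
  assumes "x \<in> urysohn R" "y \<in> urysohn R" "r \<in> R" "x r \<noteq> y r"
    and "\<And>s. s \<in> R \<Longrightarrow> x s \<noteq> y s \<Longrightarrow> s \<le> r"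
  shows "urysohn_dist R x y = r"
proof -
  have "(GREATEST r. r \<in> R \<and> x r \<noteq> y r) = r"
    using assms(3-) by (intro Greatest_equality) auto
  then show ?thesis
    using assms unfolding urysohn_dist_def by auto
qed

lemma urysohn_dist_attained:
  assumes R: "R \<subseteq> {0<..}" and x: "x \<in> urysohn R" and y: "y \<in> urysohn R" and ne: "x \<noteq> y"
  shows "urysohn_dist R x y \<in> R" "x (urysohn_dist R x y) \<noteq> y (urysohn_dist R x y)"
    and "\<And>s. s \<in> R \<Longrightarrow> x s \<noteq> y s \<Longrightarrow> s \<le> urysohn_dist R x y"
proof -
  have ext: "x \<in> R \<rightarrow>\<^sub>E UNIV" "y \<in> R \<rightarrow>\<^sub>E UNIV"
    using x y unfolding urysohn_def by auto
  obtain s where s: "s \<in> R" "x s \<noteq> y s"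
    using PiE_ext[OF ext] ne by blast
  have s0: "s / 2 > 0" "s > s / 2" using s R by auto
  define A where "A = {t \<in> R. t > s / 2 \<and> x t \<noteq> y t}"
  have "A \<subseteq> {r' \<in> R. r' > s / 2 \<and> x r' \<noteq> 0} \<union> {r' \<in> R. r' > s / 2 \<and> y r' \<noteq> 0}"
    unfolding A_def by auto
  moreover have "finite \<dots>"
    using x y s0 unfolding urysohn_def by blast
  ultimately have fin: "finite A" by (rule finite_subset)
  have sA: "s \<in> A" using s s0 unfolding A_def by auto
  have mA: "Max A \<in> A" using fin sA by (intro Max_in) auto
  have m: "t \<le> Max A" if "t \<in> R" "x t \<noteq> y t" for t
  proof (cases "t > s / 2")
    case True
    then show ?thesis using that fin unfolding A_def by simp
  next
    case False
    then show ?thesis using s0 Max_ge[OF fin sA] by linarith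
  qed
  have "urysohn_dist R x y = Max A"
    using mA m x y unfolding A_def by (intro urysohn_dist_eqI) auto
  then show "urysohn_dist R x y \<in> R" "x (urysohn_dist R x y) \<noteq> y (urysohn_dist R x y)"
    and "\<And>s. s \<in> R \<Longrightarrow> x s \<noteq> y s \<Longrightarrow> s \<le> urysohn_dist R x y"
    using mA m unfolding A_def by auto
qed

lemma urysohn_dist_commute: "urysohn_dist R x y = urysohn_dist R y x"
proof -
  have "(\<lambda>r. r \<in> R \<and> x r \<noteq> y r) = (\<lambda>r. r \<in> R \<and> y r \<noteq> x r)" by auto
  then show ?thesis unfolding urysohn_dist_def by auto
qed

lemma urysohn_dist_nonneg:
  assumes "R \<subseteq> {0<..}"
  shows "0 \<le> urysohn_dist R x y"
proof (cases "x \<in> urysohn R \<and> y \<in> urysohn R \<and> x \<noteq> y")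
  case True
  then show ?thesis using urysohn_dist_attained(1)[OF assms, of x y] assms by auto
next
  case False
  then show ?thesis unfolding urysohn_dist_def by auto
qed

lemma urysohn_dist_ultrametric:
  assumes R: "R \<subseteq> {0<..}" and "x \<in> urysohn R" "y \<in> urysohn R" "z \<in> urysohn R"
  shows "urysohn_dist R x z \<le> max (urysohn_dist R x y) (urysohn_dist R y z)"
proof (cases "x = z")
  case True
  then show ?thesis
    using urysohn_dist_nonneg[OF R, of y z] unfolding urysohn_dist_def by auto
next
  case False
  define r where "r = urysohn_dist R x z"
  have r: "r \<in> R" "x r \<noteq> z r"
    using urysohn_dist_attained[OF R assms(2,4) False] unfolding r_def by auto
  then consider "x r \<noteq> y r" | "y r \<noteq> z r" by metis
  then have "r \<le> urysohn_dist R x y \<or> r \<le> urysohn_dist R y z"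
    by cases (use urysohn_dist_attained(3)[OF R] assms r in blast)+
  then show ?thesis unfolding r_def by auto
qed

lemma Metric_space_urysohn:
  assumes R: "R \<subseteq> {0<..}"
  shows "Metric_space (urysohn R) (urysohn_dist R)"
proof
  fix x y z
  show "0 \<le> urysohn_dist R x y" by (rule urysohn_dist_nonneg[OF R])
  show "urysohn_dist R x y = urysohn_dist R y x" by (rule urysohn_dist_commute)
  assume x: "x \<in> urysohn R" and y: "y \<in> urysohn R"
  show "urysohn_dist R x y = 0 \<longleftrightarrow> x = y"
    using urysohn_dist_attained(1)[OF R x y] R unfolding urysohn_dist_def by force
  assume z: "z \<in> urysohn R"
  show "urysohn_dist R x z \<le> urysohn_dist R x y + urysohn_dist R y z"
    using urysohn_dist_ultrametric[OF R x y z]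
      urysohn_dist_nonneg[OF R, of x y] urysohn_dist_nonneg[OF R, of y z] by linarith
qed

lemma group_Iso: "group (Iso M d)"
proof -
  define S where "S = {f \<in> Bij M. \<forall>x\<in>M. \<forall>y\<in>M. d (f x) (f y) = d x y}"
  have "subgroup S (BijGroup M)"
  proof (rule group.subgroupI[OF group_BijGroup])
    show "S \<subseteq> carrier (BijGroup M)" by (auto simp: BijGroup_def S_def)
    have "(\<lambda>x\<in>M. x) \<in> S" using id_Bij[of M] unfolding S_def by simp
    then show "S \<noteq> {}" by blast
  next
    fix f assume f: "f \<in> S"
    then have B: "f \<in> Bij M" and iso: "\<And>x y. x \<in> M \<Longrightarrow> y \<in> M \<Longrightarrow> d (f x) (f y) = d x y"
      unfolding S_def by auto
    have im: "f ` M = M" using B by (auto simp: Bij_def bij_betw_def)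
    have "d (inv_into M f x) (inv_into M f y) = d x y" if "x \<in> M" "y \<in> M" for x y
      using iso[of "inv_into M f x" "inv_into M f y"] that im
      by (simp add: inv_into_into f_inv_into_f)
    then have "(\<lambda>x\<in>M. inv_into M f x) \<in> S"
      using restrict_inv_into_Bij[OF B] unfolding S_def by simp
    then show "inv\<^bsub>BijGroup M\<^esub> f \<in> S" by (simp add: inv_BijGroup[OF B])
  next
    fix f g assume "f \<in> S" "g \<in> S"
    then have f: "f \<in> Bij M" "\<And>x y. x \<in> M \<Longrightarrow> y \<in> M \<Longrightarrow> d (f x) (f y) = d x y"
      and g: "g \<in> Bij M" "\<And>x y. x \<in> M \<Longrightarrow> y \<in> M \<Longrightarrow> d (g x) (g y) = d x y"
      unfolding S_def by auto
    have gM: "\<And>x. x \<in> M \<Longrightarrow> g x \<in> M" using Bij_imp_funcset[OF g(1)] by auto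
    have "compose M f g \<in> S"
      unfolding S_def using compose_Bij[OF f(1) g(1)] by (simp add: compose_eq f(2) g(2) gM)
    then show "f \<otimes>\<^bsub>BijGroup M\<^esub> g \<in> S" by (simp add: BijGroup_def f(1) g(1))
  qed
  then show ?thesis
    unfolding Iso_def S_def by (rule subgroup.subgroup_is_group[OF _ group_BijGroup])
qed

end

theory Submission
  imports Defs
begin

text \<open>
  The isometries that move a fixed point by at most \<open>r\<close> form a subgroup, because the metric is an
  ultrametric; letting \<open>r\<close> tend to infinity gives countable cofinality.

  For ample generics, consider the diagonal conjugation action of \<open>G\<close> on \<open>G\<^sup>n\<^sup>+\<^sup>1\<close>.  A comeager orbit
  exists as soon as the action is topologically transitive and, for every neighbourhood \<open>V\<close> of the
  identity, every nonempty open set contains a nonempty open \<open>U'\<close> such that any two nonempty open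
  subsets of \<open>U'\<close> are connected by an element of \<open>V\<close>.  Here \<open>U'\<close> consists of the tuples that are close,
  on a finite set \<open>B\<close>, to a tuple of isometries preserving \<open>B\<close>; such sets are found by truncating all
  coordinates, since finite boxes of coordinates are finite and homogeneous.  Two tuples in \<open>U'\<close>,
  restricted to finite sets, are amalgamated over \<open>B\<close> with the distance
  \<open>max (max (d x b) (d b y)) e\<close> minimised over \<open>b \<in> B\<close>.  The small extra distance \<open>e\<close> absorbs the error
  with which the tuples agree on \<open>B\<close>, so both actions are isometric on the amalgam.
\<close>

section \<open>Comeager orbits of Polish group actions\<close>

text \<open>An open set of tuples controls values only up to a positive error, and \<open>R\<close>
  has arbitrarily small members, so two tuples in it never have to agree exactly on
  \<open>B\<close>. The amalgam therefore keeps two disjoint copies even over \<open>B\<close>, and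
  approximate agreement with one common permutation of \<open>B\<close> takes the place of equality.
  No generic tuple is named. Transitivity and the local condition make comeagerly many points have
  an orbit that is dense and is filled out locally by small group elements; any two such points are
  joined by an infinite zigzag, whose limits exist because the group is complete. That the group is
  Polish needs its own argument, since a pointwise limit of surjective isometries can fail to be
  surjective. Each isometry is recorded together with its inverse on a countable dense set, and the
  records form a closed set. Small members of \<open>R\<close> serve as errors; large ones give the
  strict chain of subgroups and topological transitivity.\<close>

lemma nowhere_dense_inI:
  assumes "A \<subseteq> topspace X"
    and "\<And>U. openin X U \<Longrightarrow> U \<noteq> {} \<Longrightarrow> \<exists>V. openin X V \<and> V \<noteq> {} \<and> V \<subseteq> U \<and> V \<inter> A = {}"
  shows "nowhere_dense_in X A"
proof -
  have "X interior_of (X closure_of A) = {}"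
  proof (rule ccontr)
    assume "X interior_of (X closure_of A) \<noteq> {}"
    then obtain V where V: "openin X V" "V \<noteq> {}" "V \<subseteq> X interior_of (X closure_of A)" "V \<inter> A = {}"
      using assms(2) by (meson openin_interior_of)
    then show False
      by (metis disjoint_iff equals0I in_closure_of interior_of_subset subsetD)
  qed
  with assms(1) show ?thesis unfolding nowhere_dense_in_def by simp
qed

lemma comeager_in_mono:
  assumes A: "comeager_in X A" and "A \<subseteq> B" "B \<subseteq> topspace X"
  shows "comeager_in X B"
proof -
  obtain \<N> where N: "countable \<N>" "\<forall>N\<in>\<N>. nowhere_dense_in X N" "topspace X - A = \<Union>\<N>"
    using A unfolding comeager_in_def meager_in_def by (elim conjE exE) (rule that)
  have "nowhere_dense_in X (N - B)" if "N \<in> \<N>" for N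
  proof -
    have N': "N \<subseteq> topspace X" "X interior_of (X closure_of N) = {}"
      using N(2) that unfolding nowhere_dense_in_def by auto
    have "X interior_of (X closure_of (N - B)) \<subseteq> X interior_of (X closure_of N)"
      by (intro interior_of_mono closure_of_mono) auto
    with N' show ?thesis unfolding nowhere_dense_in_def by auto
  qed
  moreover have "topspace X - B = \<Union>((\<lambda>N. N - B) ` \<N>)"
    using N(3) assms(2) by auto
  ultimately show ?thesis
    unfolding comeager_in_def meager_in_def using N(1) assms(3)
    by (intro conjI exI[of _ "(\<lambda>N. N - B) ` \<N>"]) auto
qed

lemma comeager_in_avoiding:
  assumes "countable \<N>" "\<And>N. N \<in> \<N> \<Longrightarrow> nowhere_dense_in X N"
  shows "comeager_in X (topspace X - \<Union>\<N>)"
proof -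
  have "topspace X - (topspace X - \<Union>\<N>) = \<Union>\<N>"
    using assms(2) unfolding nowhere_dense_in_def by blast
  then show ?thesis
    unfolding comeager_in_def meager_in_def using assms by auto
qed

text \<open>Basic boxes are coded by finite sets of pairs (index, basic open set), and a countable
  set has only countably many finite subsets.\<close>

lemma second_countable_product_topology:
  assumes I: "countable I" and X: "\<And>i. i \<in> I \<Longrightarrow> second_countable (X i)"
  shows "second_countable (product_topology X I)"
proof -
  have "\<forall>i. \<exists>\<B>. i \<in> I \<longrightarrow> countable \<B> \<and> (\<forall>V\<in>\<B>. openin (X i) V) \<and>
      (\<forall>U x. openin (X i) U \<and> x \<in> U \<longrightarrow> (\<exists>V\<in>\<B>. x \<in> V \<and> V \<subseteq> U))"
    using X unfolding second_countable_def by auto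
  then obtain B where B: "\<And>i. i \<in> I \<Longrightarrow> countable (B i)" "\<And>i V. i \<in> I \<Longrightarrow> V \<in> B i \<Longrightarrow> openin (X i) V"
    "\<And>i U x. i \<in> I \<Longrightarrow> openin (X i) U \<Longrightarrow> x \<in> U \<Longrightarrow> \<exists>V\<in>B i. x \<in> V \<and> V \<subseteq> U"
    by metis
  define T where "T = topspace (product_topology X I)"
  define box where "box P = {x \<in> T. \<forall>(i, V)\<in>P. x i \<in> V}" for P :: "('a \<times> 'b set) set"
  define \<P> where "\<P> = {P. finite P \<and> P \<subseteq> Sigma I B}"
  have "countable (box ` \<P>)"
    unfolding \<P>_def
    by (intro countable_image countable_Collect_finite_subset countable_SIGMA I) (use B(1) in auto)
  moreover have "openin (product_topology X I) (box P)" if P: "P \<in> \<P>" for P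
  proof -
    have "openin (product_topology X I) {x \<in> T. x (fst q) \<in> snd q}" if "q \<in> P" for q
    proof -
      have q: "fst q \<in> I" "snd q \<in> B (fst q)" using that P unfolding \<P>_def by auto
      show ?thesis unfolding T_def
        by (rule openin_continuous_map_preimage[of _ "X (fst q)"])
          (use q B(2) in \<open>auto intro: continuous_map_product_projection\<close>)
    qed
    \<comment> \<open>Intersecting with \<open>T\<close> keeps the formula right for empty
      \<open>P\<close>, where the intersection of the family alone is \<open>UNIV\<close>.\<close>
    then have "openin (product_topology X I) (T \<inter> \<Inter>((\<lambda>q. {x \<in> T. x (fst q) \<in> snd q}) ` P))"
      using P unfolding \<P>_def T_def
      by (cases "P = {}") (auto simp del: topspace_product_topology intro!: openin_Int openin_INT2)
    moreover have "box P = T \<inter> \<Inter>((\<lambda>q. {x \<in> T. x (fst q) \<in> snd q}) ` P)"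
      unfolding box_def by fastforce
    ultimately show ?thesis by simp
  qed
  moreover have "\<exists>V\<in>box ` \<P>. x \<in> V \<and> V \<subseteq> U"
    if U: "openin (product_topology X I) U" "x \<in> U" for U x
  proof -
    obtain W where W: "finite {i \<in> I. W i \<noteq> topspace (X i)}" "\<forall>i\<in>I. openin (X i) (W i)"
      "x \<in> Pi\<^sub>E I W" "Pi\<^sub>E I W \<subseteq> U"
      using U unfolding openin_product_topology_alt by blast
    define F where "F = {i \<in> I. W i \<noteq> topspace (X i)}"
    have "\<exists>V\<in>B i. x i \<in> V \<and> V \<subseteq> W i" if "i \<in> I" for i
      using B(3)[OF that] W(2,3) that by (meson PiE_mem)
    then obtain V where V: "\<And>i. i \<in> I \<Longrightarrow> V i \<in> B i \<and> x i \<in> V i \<and> V i \<subseteq> W i"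
      by metis
    have "(\<lambda>i. (i, V i)) ` F \<in> \<P>"
      using W(1) V unfolding \<P>_def F_def by auto
    moreover have "x \<in> T" using openin_subset[OF U(1)] U(2) unfolding T_def by auto
    moreover have "box ((\<lambda>i. (i, V i)) ` F) \<subseteq> Pi\<^sub>E I W"
    proof
      fix y assume y: "y \<in> box ((\<lambda>i. (i, V i)) ` F)"
      then have yT: "y \<in> Pi\<^sub>E I (topspace \<circ> X)" unfolding box_def T_def by auto
      show "y \<in> Pi\<^sub>E I W"
      proof (rule PiE_I)
        fix i assume i: "i \<in> I"
        show "y i \<in> W i"
        proof (cases "i \<in> F")
          case True
          then show ?thesis using y V[OF i] unfolding box_def by auto
        next
          case False
          then show ?thesis using yT i unfolding F_def by auto
        qed
      next
        fix i assume "i \<notin> I" then show "y i = undefined" using yT by auto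
      qed
    qed
    moreover have "x \<in> box ((\<lambda>i. (i, V i)) ` F)"
      using \<open>x \<in> T\<close> V unfolding box_def F_def by auto
    ultimately show ?thesis using W(4) by blast
  qed
  ultimately show ?thesis
    unfolding second_countable_def by (intro exI[of _ "box ` \<P>"]) simp
qed

text \<open>Continuity is asked separately in each variable: translations pull back open sets of
  \<open>Z\<close>, and orbit maps carry limits from the group to \<open>Z\<close>. Completeness is
  asked of \<open>T\<close> because the limits are taken in the group.\<close>

locale polish_action = Metric_space Z dZ for Z :: "'z set" and dZ +
  fixes G :: "('g, 'm) monoid_scheme" and T :: "'g topology"
    and act :: "'g \<Rightarrow> 'z \<Rightarrow> 'z"
  assumes tg: "topological_group G T" and complete: "completely_metrizable_space T"
    and Z_sc: "second_countable mtopology"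
    and act_closed: "\<And>g z. g \<in> carrier G \<Longrightarrow> z \<in> Z \<Longrightarrow> act g z \<in> Z"
    and act_one: "\<And>z. z \<in> Z \<Longrightarrow> act \<one>\<^bsub>G\<^esub> z = z"
    and act_mult: "\<And>g h z. g \<in> carrier G \<Longrightarrow> h \<in> carrier G \<Longrightarrow> z \<in> Z \<Longrightarrow>
      act (g \<otimes>\<^bsub>G\<^esub> h) z = act g (act h z)"
    and act_cont: "\<And>g. g \<in> carrier G \<Longrightarrow> continuous_map mtopology mtopology (act g)"
    and orbit_cont: "\<And>z. z \<in> Z \<Longrightarrow> continuous_map T mtopology (\<lambda>g. act g z)"
begin

lemma group_G: "group G" and topspace_T: "topspace T = carrier G"
  using tg unfolding topological_group_def by auto

sublocale G: group G by (rule group_G)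

lemma left_mult_cont:
  assumes "g \<in> carrier G"
  shows "continuous_map T T (\<lambda>v. g \<otimes>\<^bsub>G\<^esub> v)"
proof -
  have "continuous_map T (prod_topology T T) (\<lambda>v. (g, v))"
    using assms topspace_T by (intro continuous_map_pairedI) auto
  then have "continuous_map T T ((\<lambda>(x, y). x \<otimes>\<^bsub>G\<^esub> y) \<circ> (\<lambda>v. (g, v)))"
    using tg unfolding topological_group_def by (blast intro: continuous_map_compose)
  then show ?thesis by (simp add: o_def)
qed

lemma openin_act_vimage:
  assumes "g \<in> carrier G" "openin mtopology W"
  shows "openin mtopology {z \<in> Z. act g z \<in> W}"
  using openin_continuous_map_preimage[OF act_cont[OF assms(1)] assms(2)] by simp

lemma act_inv_cancel:
  assumes "g \<in> carrier G" "z \<in> Z"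
  shows "act (inv\<^bsub>G\<^esub> g) (act g z) = z" "act g (act (inv\<^bsub>G\<^esub> g) z) = z"
  using assms act_mult[of "inv\<^bsub>G\<^esub> g" g z] act_mult[of g "inv\<^bsub>G\<^esub> g" z] act_one by auto

text \<open>In other words, \<open>act g z\<close> lies in the interior of the closure of the set of
  translates of \<open>z\<close> by \<open>V\<close>. All \<open>g\<close> are covered because the
  zigzag applies this at moving group elements.\<close>

definition locally_dense_orbit :: "'z \<Rightarrow> bool" where
  "locally_dense_orbit z \<longleftrightarrow> (\<forall>g V. g \<in> V \<longrightarrow> openin T V \<longrightarrow>
     (\<exists>U. openin mtopology U \<and> act g z \<in> U \<and>
       (\<forall>W. openin mtopology W \<longrightarrow> W \<noteq> {} \<longrightarrow> W \<subseteq> U \<longrightarrow> (\<exists>v\<in>V. act v z \<in> W))))"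

text \<open>Translation reduces everything to the identity: \<open>V\<close> is pulled back by left
  multiplication with \<open>g\<close>, and the open set found there is carried forward by
  \<open>act g\<close>.\<close>

lemma locally_dense_orbitI:
  assumes z: "z \<in> Z"
    and P: "\<And>V. \<one>\<^bsub>G\<^esub> \<in> V \<Longrightarrow> openin T V \<Longrightarrow> \<exists>U. openin mtopology U \<and> z \<in> U \<and>
       (\<forall>W. openin mtopology W \<longrightarrow> W \<noteq> {} \<longrightarrow> W \<subseteq> U \<longrightarrow> (\<exists>v\<in>V. act v z \<in> W))"
  shows "locally_dense_orbit z"
  unfolding locally_dense_orbit_def
proof (intro allI impI)
  fix g V assume gV: "g \<in> V" "openin T V"
  then have g: "g \<in> carrier G" using openin_subset topspace_T by auto
  define V' where "V' = {v \<in> carrier G. g \<otimes>\<^bsub>G\<^esub> v \<in> V}"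
  have V': "\<one>\<^bsub>G\<^esub> \<in> V'" "openin T V'"
    using openin_continuous_map_preimage[OF left_mult_cont[OF g] gV(2)] gV g
    unfolding V'_def topspace_T by auto
  obtain U where U: "openin mtopology U" "z \<in> U"
    "\<And>W. openin mtopology W \<Longrightarrow> W \<noteq> {} \<Longrightarrow> W \<subseteq> U \<Longrightarrow> \<exists>v\<in>V'. act v z \<in> W"
    using P[OF V'] by blast
  define U' where "U' = {y \<in> Z. act (inv\<^bsub>G\<^esub> g) y \<in> U}"
  have "openin mtopology U'" unfolding U'_def using U(1) g by (intro openin_act_vimage) auto
  moreover have "act g z \<in> U'" unfolding U'_def using act_closed[OF g z] act_inv_cancel[OF g z] U(2) by simp
  moreover have "\<exists>v\<in>V. act v z \<in> W" if W: "openin mtopology W" "W \<noteq> {}" "W \<subseteq> U'" for W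
  proof -
    have WZ: "W \<subseteq> Z" using openin_subset[OF W(1)] by simp
    obtain w where w: "w \<in> W" using W by auto
    let ?W = "{z \<in> Z. act g z \<in> W}"
    have "act (inv\<^bsub>G\<^esub> g) w \<in> ?W" using w WZ g act_closed act_inv_cancel(2)[OF g] by auto
    moreover have "?W \<subseteq> U"
    proof
      fix y assume y: "y \<in> ?W"
      then have "act (inv\<^bsub>G\<^esub> g) (act g y) \<in> U" using W(3) unfolding U'_def by auto
      then show "y \<in> U" using y act_inv_cancel[OF g] by auto
    qed
    ultimately obtain v where v: "v \<in> V'" "act v z \<in> ?W"
      using U(3)[OF openin_act_vimage[OF g W(1)]] by auto
    then have "g \<otimes>\<^bsub>G\<^esub> v \<in> V" "act (g \<otimes>\<^bsub>G\<^esub> v) z \<in> W"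
      using act_mult[OF g _ z] unfolding V'_def by auto
    then show ?thesis by blast
  qed
  ultimately show "\<exists>U. openin mtopology U \<and> act g z \<in> U \<and>
       (\<forall>W. openin mtopology W \<longrightarrow> W \<noteq> {} \<longrightarrow> W \<subseteq> U \<longrightarrow> (\<exists>v\<in>V. act v z \<in> W))"
    by blast
qed

text \<open>
  A zigzag: the two points are moved alternately into shrinking open sets, by group elements that
  form Cauchy sequences.
\<close>

lemma locally_dense_orbits_meet:
  assumes z: "z \<in> Z" "locally_dense_orbit z" and z': "z' \<in> Z" "locally_dense_orbit z'"
    and dense: "\<And>W. openin mtopology W \<Longrightarrow> W \<noteq> {} \<Longrightarrow> \<exists>g\<in>carrier G. act g z' \<in> W"
  shows "\<exists>g\<in>carrier G. act g z = z'"
proof -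
  obtain \<rho> where R: "Metric_space (carrier G) \<rho>" "Metric_space.mcomplete (carrier G) \<rho>"
      "T = Metric_space.mtopology (carrier G) \<rho>"
    using complete topspace_T unfolding completely_metrizable_space_def
    by (metis Metric_space.topspace_mtopology)
  interpret R: Metric_space "carrier G" \<rho> by (rule R(1))
  \<comment> \<open>Round \<open>n\<close> moves each group element by less than
    \<open>(1/2) ^ n\<close>; these bounds are summable, so both sequences are Cauchy.\<close>
  define N where "N n g = R.mball g ((1/2) ^ n)" for n :: nat and g
  have N: "openin T (N n g)" "N n g \<subseteq> carrier G" for n g
    unfolding N_def R(3) using R.mball_subset_mspace by auto
  have N_centre: "g \<in> N n g" if "g \<in> carrier G" for n g unfolding N_def using that by simp
  define dense_in where "dense_in n g U \<longleftrightarrow> openin mtopology U \<and> act g z \<in> U \<and>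
       (\<forall>W. openin mtopology W \<longrightarrow> W \<noteq> {} \<longrightarrow> W \<subseteq> U \<longrightarrow> (\<exists>v\<in>N n g. act v z \<in> W))" for n g U
  \<comment> \<open>In a state \<open>(g, g', U)\<close> both current points lie in
    \<open>U\<close>, and elements near \<open>g\<close> move \<open>z\<close> densely through
    \<open>U\<close>; hence \<open>z\<close> can be moved next.\<close>
  define Inv where "Inv n s \<longleftrightarrow> (case s of (g, g', U) \<Rightarrow>
    g \<in> carrier G \<and> g' \<in> carrier G \<and> dense_in n g U \<and> act g' z' \<in> U)" for n s
  \<comment> \<open>Both new points lie within \<open>(1/2) ^ n\<close> of \<open>act g' z'\<close>,
    whence the factor \<open>2\<close>.\<close>
  define Rel :: "nat \<Rightarrow> 'g \<times> 'g \<times> 'z set \<Rightarrow> 'g \<times> 'g \<times> 'z set \<Rightarrow> bool" where "Rel n s t \<longleftrightarrow> (case s of (g, g', U) \<Rightarrow> case t of (h, h', U1) \<Rightarrow>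
    h \<in> N n g \<and> h' \<in> N n g' \<and> dZ (act h z) (act h' z') < 2 * (1/2) ^ n)" for n s t
  have "\<exists>s. Inv 0 s"
  proof -
    obtain U where U: "dense_in 0 \<one>\<^bsub>G\<^esub> U"
      using z(2) N(1)[of 0 "\<one>\<^bsub>G\<^esub>"] N_centre[of "\<one>\<^bsub>G\<^esub>" 0]
      unfolding locally_dense_orbit_def dense_in_def by blast
    then obtain g' where "g' \<in> carrier G" "act g' z' \<in> U"
      using dense[of U] unfolding dense_in_def by blast
    then have "Inv 0 (\<one>\<^bsub>G\<^esub>, g', U)" using U unfolding Inv_def by auto
    then show ?thesis by blast
  qed
  moreover have "\<exists>t. Inv (Suc n) t \<and> Rel n s t" if "Inv n s" for s n
  proof -
    obtain g g' U where s: "s = (g, g', U)" by (metis prod.exhaust)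
    have g: "g \<in> carrier G" "g' \<in> carrier G" "dense_in n g U" "act g' z' \<in> U"
      using that unfolding Inv_def s by auto
    obtain U1 where U1: "openin mtopology U1" "act g' z' \<in> U1"
      "\<And>W. openin mtopology W \<Longrightarrow> W \<noteq> {} \<Longrightarrow> W \<subseteq> U1 \<Longrightarrow> \<exists>v\<in>N n g'. act v z' \<in> W"
      using z'(2) N(1)[of n g'] N_centre[OF g(2), of n] unfolding locally_dense_orbit_def by blast
    define B where "B = mball (act g' z') ((1/2) ^ n)"
    have gz': "act g' z' \<in> Z" using g z' act_closed by blast
    have UB: "openin mtopology (U \<inter> (U1 \<inter> B))" "act g' z' \<in> U \<inter> (U1 \<inter> B)"
      using g(3,4) U1 gz' unfolding dense_in_def B_def by (auto intro!: openin_Int)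
    then obtain h where h: "h \<in> N n g" "act h z \<in> U \<inter> (U1 \<inter> B)"
      using g(3) unfolding dense_in_def by blast
    have hG: "h \<in> carrier G" using h N(2) by blast
    obtain U2 where U2: "dense_in (Suc n) h U2"
      using z(2) N(1)[of "Suc n" h] N_centre[OF hG, of "Suc n"]
      unfolding locally_dense_orbit_def dense_in_def by blast
    \<comment> \<open>Shrinking into \<open>U1\<close> lets an element near \<open>g'\<close> bring
      \<open>z'\<close> after \<open>z\<close>; shrinking into \<open>B\<close> makes the two points
      approach each other.\<close>
    define U3 where "U3 = U2 \<inter> (U \<inter> (U1 \<inter> B))"
    have U3: "dense_in (Suc n) h U3"
      using U2 h UB unfolding dense_in_def U3_def by (auto intro!: openin_Int)
    have "openin mtopology U3" "U3 \<noteq> {}" "U3 \<subseteq> U1"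
      using U3 unfolding dense_in_def U3_def by auto
    then obtain h' where h': "h' \<in> N n g'" "act h' z' \<in> U3" using U1(3) by blast
    have "act h' z' \<in> B" "act h z \<in> B" using h' h unfolding U3_def by auto
    then have "dZ (act h z) (act h' z') < 2 * (1/2) ^ n"
      unfolding B_def in_mball
      using triangle[of "act h z" "act g' z'" "act h' z'"] commute[of "act h z" "act g' z'"] by linarith
    then have "Inv (Suc n) (h, h', U3) \<and> Rel n s (h, h', U3)"
      unfolding Inv_def Rel_def s using h h' hG U3 N(2) by auto
    then show ?thesis by blast
  qed
  ultimately have "\<exists>f. \<forall>n. Inv n (f n) \<and> Rel n (f n) (f (Suc n))"
    by (intro dependent_nat_choice) auto
  then obtain f where f: "\<And>n. Inv n (f n)" "\<And>n. Rel n (f n) (f (Suc n))" by blast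
  define g where "g n = fst (f n)" for n
  define g' where "g' n = fst (snd (f n))" for n
  have gG: "g n \<in> carrier G" "g' n \<in> carrier G" for n
    using f(1)[of n] unfolding Inv_def g_def g'_def by (auto split: prod.splits)
  have step: "g (Suc n) \<in> N n (g n)" "g' (Suc n) \<in> N n (g' n)"
    "dZ (act (g (Suc n)) z) (act (g' (Suc n)) z') < 2 * (1/2) ^ n" for n
    using f(2)[of n] unfolding Rel_def g_def g'_def by (auto split: prod.splits)
  have lim: "\<exists>l. limitin T \<gamma> l sequentially" if \<gamma>: "\<And>n. \<gamma> n \<in> carrier G"
    and st: "\<And>n. \<gamma> (Suc n) \<in> N n (\<gamma> n)" for \<gamma>
  proof -
    \<comment> \<open>The right-hand side is the exact value of the geometric sum of the step bounds
      from \<open>m\<close> to \<open>m + k - 1\<close>, so the induction closes.\<close>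
    have bound: "\<rho> (\<gamma> m) (\<gamma> (m + k)) \<le> 2 * (1/2) ^ m - 2 * (1/2) ^ (m + k)" for m k
    proof (induction k)
      case 0
      then show ?case using \<gamma> by simp
    next
      case (Suc k)
      have "\<rho> (\<gamma> (m + k)) (\<gamma> (Suc (m + k))) < (1/2) ^ (m + k)"
        using st[of "m + k"] unfolding N_def by simp
      then show ?case
        using Suc R.triangle[OF \<gamma>[of m] \<gamma>[of "m + k"] \<gamma>[of "Suc (m + k)"]] by simp
    qed
    have "R.MCauchy \<gamma>"
      unfolding R.MCauchy_def
    proof (intro conjI allI impI)
      show "range \<gamma> \<subseteq> carrier G" using \<gamma> by auto
      fix e :: real assume e: "e > 0"
      obtain K where K: "(1/2 :: real) ^ K < e / 4"
        using real_arch_pow_inv[of "e / 4" "1/2"] e by auto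
      have "\<rho> (\<gamma> n) (\<gamma> n') < e" if "K \<le> n" "K \<le> n'" for n n'
      proof -
        have *: "\<rho> (\<gamma> K) (\<gamma> m) < e / 2" if "K \<le> m" for m
        proof -
          have pos: "(0::real) < (1/2) ^ m" by simp
          have "\<rho> (\<gamma> K) (\<gamma> m) \<le> 2 * (1/2) ^ K - 2 * (1/2) ^ m"
            using bound[of K "m - K"] that by simp
          with pos K show ?thesis by linarith
        qed
        show ?thesis
          using *[OF that(1)] *[OF that(2)] R.triangle[OF \<gamma>[of n] \<gamma>[of K] \<gamma>[of n']]
            R.commute[of "\<gamma> n" "\<gamma> K"] by linarith
      qed
      then show "\<exists>K. \<forall>n n'. K \<le> n \<longrightarrow> K \<le> n' \<longrightarrow> \<rho> (\<gamma> n) (\<gamma> n') < e" by blast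
    qed
    then show ?thesis using R(2) unfolding R.mcomplete_def R(3) by blast
  qed
  obtain l l' where l: "limitin T g l sequentially" and l': "limitin T g' l' sequentially"
    using lim[of g] lim[of g'] gG step by blast
  have lG: "l \<in> carrier G" "l' \<in> carrier G"
    using l l' unfolding limitin_def topspace_T by auto
  have conv: "limitin mtopology (\<lambda>n. act (g (Suc n)) z) (act l z) sequentially"
    "limitin mtopology (\<lambda>n. act (g' (Suc n)) z') (act l' z') sequentially"
    using continuous_map_limit[OF orbit_cont[OF z(1)] l] continuous_map_limit[OF orbit_cont[OF z'(1)] l']
      limitin_sequentially_offset[of _ "\<lambda>n. act (g n) z" "act l z" 1]
      limitin_sequentially_offset[of _ "\<lambda>n. act (g' n) z'" "act l' z'" 1]
    by (simp_all add: o_def)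
  have "(\<lambda>n. 2 * (1/2) ^ n :: real) \<longlonglongrightarrow> 0"
    using tendsto_mult_right_zero[OF LIMSEQ_power_zero[of "1/2::real"]] by simp
  then have null: "(\<lambda>n. dZ (act (g (Suc n)) z) (act (g' (Suc n)) z')) \<longlonglongrightarrow> 0"
    by (rule tendsto_sandwich[OF _ _ tendsto_const, rotated 2])
       (use step(3) less_imp_le in \<open>auto intro!: always_eventually\<close>)
  have "dZ (act l z) (act l' z') = 0"
  proof (rule ccontr)
    assume "dZ (act l z) (act l' z') \<noteq> 0"
    then have e: "dZ (act l z) (act l' z') / 3 > 0" (is "?e > 0")
      using nonneg[of "act l z" "act l' z'"] by linarith
    have ev: "\<forall>\<^sub>F n in sequentially. dZ (act (g (Suc n)) z) (act l z) < ?e"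
      "\<forall>\<^sub>F n in sequentially. dZ (act (g' (Suc n)) z') (act l' z') < ?e"
      using conv[unfolded limitin_metric, THEN conjunct2, rule_format, OF e]
      by (auto simp: eventually_conj_iff)
    have "\<forall>\<^sub>F n in sequentially. dZ (act (g (Suc n)) z) (act l z) < ?e \<and>
        dZ (act (g' (Suc n)) z') (act l' z') < ?e \<and> dZ (act (g (Suc n)) z) (act (g' (Suc n)) z') < ?e"
      by (intro eventually_conj ev order_tendstoD(2)[OF null e])
    then obtain n where n: "dZ (act (g (Suc n)) z) (act l z) < ?e"
        "dZ (act (g' (Suc n)) z') (act l' z') < ?e" "dZ (act (g (Suc n)) z) (act (g' (Suc n)) z') < ?e"
      by (auto simp: eventually_sequentially)
    have "act (g (Suc n)) z \<in> Z" "act (g' (Suc n)) z' \<in> Z" "act l z \<in> Z" "act l' z' \<in> Z"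
      using gG lG z z' act_closed by auto
    then show False
      using n triangle[of "act l z" "act (g (Suc n)) z" "act l' z'"]
        triangle[of "act (g (Suc n)) z" "act (g' (Suc n)) z'" "act l' z'"]
        commute[of "act l z" "act (g (Suc n)) z"] by linarith
  qed
  then have "act l z = act l' z'" using lG z z' act_closed by simp
  then have "act (inv\<^bsub>G\<^esub> l' \<otimes>\<^bsub>G\<^esub> l) z = z'"
    using lG z(1) z'(1) act_mult[of "inv\<^bsub>G\<^esub> l'" l z] act_inv_cancel by simp
  then show ?thesis using lG by blast
qed

text \<open>Transitivity makes generic orbits dense, and the local condition makes them locally
  dense. By the zigzag any two generic points lie in one orbit, which then contains a comeager
  set.\<close>

theorem comeager_orbit:
  assumes ne: "Z \<noteq> {}"
    and transitive: "\<And>W1 W2. openin mtopology W1 \<Longrightarrow> W1 \<noteq> {} \<Longrightarrow> openin mtopology W2 \<Longrightarrow> W2 \<noteq> {} \<Longrightarrow>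
      \<exists>g\<in>carrier G. \<exists>z\<in>W1. act g z \<in> W2"
    and local: "\<And>V U. openin T V \<Longrightarrow> \<one>\<^bsub>G\<^esub> \<in> V \<Longrightarrow> openin mtopology U \<Longrightarrow> U \<noteq> {} \<Longrightarrow>
      \<exists>U'. openin mtopology U' \<and> U' \<noteq> {} \<and> U' \<subseteq> U \<and>
        (\<forall>W1 W2. openin mtopology W1 \<longrightarrow> W1 \<noteq> {} \<longrightarrow> W1 \<subseteq> U' \<longrightarrow>
          openin mtopology W2 \<longrightarrow> W2 \<noteq> {} \<longrightarrow> W2 \<subseteq> U' \<longrightarrow> (\<exists>v\<in>V. \<exists>z\<in>W1. act v z \<in> W2))"
  shows "\<exists>z\<in>Z. comeager_in mtopology ((\<lambda>g. act g z) ` carrier G)"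
proof -
  obtain \<B> where "countable \<B>" "\<forall>V\<in>\<B>. openin mtopology V"
    "\<forall>U x. openin mtopology U \<and> x \<in> U \<longrightarrow> (\<exists>V\<in>\<B>. x \<in> V \<and> V \<subseteq> U)"
    using Z_sc unfolding second_countable_def by (elim exE conjE) (rule that)
  note \<B> = this(1) this(2)[rule_format] this(3)[rule_format, OF conjI]
  have "first_countable T"
    using complete completely_metrizable_imp_metrizable_space metrizable_imp_first_countable by blast
  then have "\<exists>\<V>. countable \<V> \<and> (\<forall>V\<in>\<V>. openin T V) \<and>
      (\<forall>U. openin T U \<and> \<one>\<^bsub>G\<^esub> \<in> U \<longrightarrow> (\<exists>V\<in>\<V>. \<one>\<^bsub>G\<^esub> \<in> V \<and> V \<subseteq> U))"
    unfolding first_countable_def topspace_T by (rule bspec[OF _ G.one_closed])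
  then obtain \<V> where "countable \<V>" "\<forall>V\<in>\<V>. openin T V"
    "\<forall>U. openin T U \<and> \<one>\<^bsub>G\<^esub> \<in> U \<longrightarrow> (\<exists>V\<in>\<V>. \<one>\<^bsub>G\<^esub> \<in> V \<and> V \<subseteq> U)"
    by (elim exE conjE) (rule that)
  note \<V> = this(1) this(2)[rule_format] this(3)[rule_format, OF conjI]
  define good where "good V U \<longleftrightarrow> openin mtopology U \<and> 
        (\<forall>W1 W2. openin mtopology W1 \<longrightarrow> W1 \<noteq> {} \<longrightarrow> W1 \<subseteq> U \<longrightarrow>
          openin mtopology W2 \<longrightarrow> W2 \<noteq> {} \<longrightarrow> W2 \<subseteq> U \<longrightarrow> (\<exists>v\<in>V. \<exists>z\<in>W1. act v z \<in> W2))" for V U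
  \<comment> \<open>\<open>A V\<close> holds the points without a good neighbourhood for
    \<open>V\<close>; \<open>B V U W\<close> holds the points of \<open>U\<close> that
    \<open>V\<close> fails to move into \<open>W\<close>. Avoiding them for countably many basic
    sets gives local density, and the case of the whole group gives density.\<close>
  define A where "A V = Z - \<Union>{U. good V U}" for V
  define B where "B V U W = {z \<in> U. \<forall>v\<in>V. act v z \<notin> W}" for V U W
  define \<N> where "\<N> = A ` {V \<in> \<V>. \<one>\<^bsub>G\<^esub> \<in> V} \<union>
    (\<lambda>(V, U, W). B V U W) ` {(V, U, W) \<in> \<V> \<times> \<B> \<times> \<B>. good V U \<and> W \<subseteq> U \<and> W \<noteq> {}} \<union>
    (\<lambda>W. B (carrier G) Z W) ` {W \<in> \<B>. W \<noteq> {}}"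
  have B_nd: "nowhere_dense_in mtopology (B V U W)"
    if V: "V \<subseteq> carrier G" and U: "openin mtopology U" and W: "openin mtopology W"
      and meet: "\<And>Q. openin mtopology Q \<Longrightarrow> Q \<noteq> {} \<Longrightarrow> Q \<subseteq> U \<Longrightarrow> \<exists>v\<in>V. \<exists>z\<in>Q. act v z \<in> W" for V U W
  proof (rule nowhere_dense_inI)
    show "B V U W \<subseteq> topspace mtopology" unfolding B_def using openin_subset[OF U] by auto
    fix Q assume Q: "openin mtopology Q" "Q \<noteq> {}"
    show "\<exists>Q'. openin mtopology Q' \<and> Q' \<noteq> {} \<and> Q' \<subseteq> Q \<and> Q' \<inter> B V U W = {}"
    proof (cases "Q \<inter> U = {}")
      case True
      then show ?thesis using Q unfolding B_def by blast
    next
      case False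
      then obtain v z where vz: "v \<in> V" "z \<in> Q \<inter> U" "act v z \<in> W"
        using meet[of "Q \<inter> U"] Q U by (meson Int_lower2 openin_Int)
      let ?Q = "{z \<in> Z. act v z \<in> W} \<inter> Q"
      have "openin mtopology ?Q" using openin_act_vimage[of v W] V vz W Q by (blast intro: openin_Int)
      moreover have "z \<in> ?Q" using vz openin_subset[OF U] by auto
      moreover have "?Q \<inter> B V U W = {}" unfolding B_def using vz by auto
      ultimately show ?thesis by blast
    qed
  qed
  have "countable \<N>"
  proof -
    have "countable {(V, U, W) \<in> \<V> \<times> \<B> \<times> \<B>. good V U \<and> W \<subseteq> U \<and> W \<noteq> {}}"
      by (rule countable_subset[of _ "\<V> \<times> \<B> \<times> \<B>"]) (use \<B>(1) \<V>(1) in auto)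
    moreover have "countable {V \<in> \<V>. \<one>\<^bsub>G\<^esub> \<in> V}" "countable {W \<in> \<B>. W \<noteq> {}}"
      using \<B>(1) \<V>(1) by (auto intro: countable_subset)
    ultimately show ?thesis unfolding \<N>_def by auto
  qed
  moreover have "nowhere_dense_in mtopology N" if N: "N \<in> \<N>" for N
  proof -
    consider V where "N = A V" "V \<in> \<V>" "\<one>\<^bsub>G\<^esub> \<in> V"
      | V U W where "N = B V U W" "V \<in> \<V>" "U \<in> \<B>" "W \<in> \<B>" "good V U" "W \<subseteq> U" "W \<noteq> {}"
      | W where "N = B (carrier G) Z W" "W \<in> \<B>" "W \<noteq> {}"
    proof -
      have "(\<exists>V. N = A V \<and> V \<in> \<V> \<and> \<one>\<^bsub>G\<^esub> \<in> V) \<or>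
        (\<exists>V U W. N = B V U W \<and> V \<in> \<V> \<and> U \<in> \<B> \<and> W \<in> \<B> \<and> good V U \<and> W \<subseteq> U \<and> W \<noteq> {}) \<or>
        (\<exists>W. N = B (carrier G) Z W \<and> W \<in> \<B> \<and> W \<noteq> {})"
        using N unfolding \<N>_def by fast
      then show thesis by (elim disjE exE conjE) (rule that; assumption)+
    qed
    then show ?thesis
    proof cases
      case 1
      show ?thesis
      proof (rule nowhere_dense_inI)
        show "N \<subseteq> topspace mtopology" unfolding 1 A_def by auto
        fix Q assume Q: "openin mtopology Q" "Q \<noteq> {}"
        have "\<exists>U. good V U \<and> U \<noteq> {} \<and> U \<subseteq> Q"
          using local[OF \<V>(2)[OF 1(2)] 1(3) Q] unfolding good_def by (elim exE conjE) (intro exI conjI; assumption)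
        then show "\<exists>Q'. openin mtopology Q' \<and> Q' \<noteq> {} \<and> Q' \<subseteq> Q \<and> Q' \<inter> N = {}"
          unfolding 1 A_def good_def by (elim exE conjE) (intro exI conjI, assumption+, blast)
      qed
    next
      case 2
      have "V \<subseteq> carrier G" using openin_subset[OF \<V>(2)] 2 topspace_T by blast
      moreover have "\<exists>v\<in>V. \<exists>z\<in>Q. act v z \<in> W" if "openin mtopology Q" "Q \<noteq> {}" "Q \<subseteq> U" for Q
        using 2 that \<B>(2)[of W] unfolding good_def by blast
      ultimately show ?thesis unfolding 2 using 2 \<B>(2) by (intro B_nd)
    next
      case 3
      show ?thesis unfolding 3
        using transitive \<B>(2) 3 by (intro B_nd) auto
    qed
  qed
  ultimately have co: "comeager_in mtopology (Z - \<Union>\<N>)"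
    using comeager_in_avoiding[of \<N> mtopology] by simp
  have dense: "\<exists>g\<in>carrier G. act g z \<in> W"
    if "z \<in> Z - \<Union>\<N>" "openin mtopology W" "W \<noteq> {}" for z W
  proof -
    obtain W' where "W' \<in> \<B>" "W' \<noteq> {}" "W' \<subseteq> W" using \<B>(3) \<open>openin mtopology W\<close> \<open>W \<noteq> {}\<close> by blast
    then have "B (carrier G) Z W' \<in> \<N>" unfolding \<N>_def by (intro UnI2 imageI) auto
    then have "z \<notin> B (carrier G) Z W'" using that by blast
    then show ?thesis unfolding B_def using that(1) \<open>W' \<subseteq> W\<close> by blast
  qed
  have ldo: "locally_dense_orbit z" if z: "z \<in> Z - \<Union>\<N>" for z
  proof (rule locally_dense_orbitI)
    show "z \<in> Z" using z by blast
    fix V assume "\<one>\<^bsub>G\<^esub> \<in> V" "openin T V"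
    then obtain V' where V': "V' \<in> \<V>" "\<one>\<^bsub>G\<^esub> \<in> V'" "V' \<subseteq> V" using \<V>(3) by blast
    then have "A V' \<in> \<N>" unfolding \<N>_def by auto
    then have "z \<notin> A V'" using z by blast
    then obtain U0 where U0: "good V' U0" "z \<in> U0" unfolding A_def using z by auto
    have "openin mtopology U0" using U0(1) unfolding good_def by (rule conjunct1)
    then obtain U where U: "U \<in> \<B>" "z \<in> U" "U \<subseteq> U0" using \<B>(3) U0(2) by blast
    \<comment> \<open>Goodness passes to open subsets, so the neighbourhood can be taken from the
      countable basis, to which the sets in \<open>\<N>\<close> refer.\<close>
    have gU: "good V' U"
      unfolding good_def
    proof (intro conjI allI impI)
      fix W1 W2 assume "openin mtopology W1" "W1 \<noteq> {}" "W1 \<subseteq> U" "openin mtopology W2" "W2 \<noteq> {}" "W2 \<subseteq> U"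
      with U0(1)[unfolded good_def, THEN conjunct2, rule_format, of W1 W2] U(3)
      show "\<exists>v\<in>V'. \<exists>z\<in>W1. act v z \<in> W2" by fast
    qed (rule \<B>(2)[OF U(1)])
    have "\<exists>v\<in>V. act v z \<in> W" if W: "openin mtopology W" "W \<noteq> {}" "W \<subseteq> U" for W
    proof -
      obtain W' where W': "W' \<in> \<B>" "W' \<noteq> {}" "W' \<subseteq> W" using \<B>(3) W by blast
      then have "(V', U, W') \<in> {(V, U, W) \<in> \<V> \<times> \<B> \<times> \<B>. good V U \<and> W \<subseteq> U \<and> W \<noteq> {}}"
        using V' U gU W by auto
      then have "B V' U W' \<in> \<N>"
        unfolding \<N>_def by (intro UnI1[OF UnI2] image_eqI[of _ _ "(V', U, W')"]) simp
      then have "z \<notin> B V' U W'" using z by blast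
      then show ?thesis unfolding B_def using U W' V' by auto
    qed
    then show "\<exists>U. openin mtopology U \<and> z \<in> U \<and>
       (\<forall>W. openin mtopology W \<longrightarrow> W \<noteq> {} \<longrightarrow> W \<subseteq> U \<longrightarrow> (\<exists>v\<in>V. act v z \<in> W))"
      using U(2) \<B>(2)[OF U(1)] by blast
  qed
  \<comment> \<open>If \<open>Z - \<Union>\<N>\<close> is empty then \<open>Z\<close> is meager and any orbit will do.\<close>
  obtain z where z: "z \<in> Z" "Z - \<Union>\<N> \<noteq> {} \<longrightarrow> z \<in> Z - \<Union>\<N>" using ne by blast
  have "Z - \<Union>\<N> \<subseteq> (\<lambda>g. act g z) ` carrier G"
  proof
    fix z' assume z': "z' \<in> Z - \<Union>\<N>"
    then have "\<exists>g\<in>carrier G. act g z = z'"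
      using locally_dense_orbits_meet[of z z'] ldo dense[of z'] z by blast
    then show "z' \<in> (\<lambda>g. act g z) ` carrier G" by blast
  qed
  moreover have "(\<lambda>g. act g z) ` carrier G \<subseteq> topspace mtopology" using act_closed z by auto
  ultimately show ?thesis using comeager_in_mono[OF co] z(1) by blast
qed

end

lemma continuous_map_mult:
  assumes "topological_group G T" "continuous_map S T f" "continuous_map S T g"
  shows "continuous_map S T (\<lambda>x. f x \<otimes>\<^bsub>G\<^esub> g x)"
proof -
  have "continuous_map S T ((\<lambda>(x, y). x \<otimes>\<^bsub>G\<^esub> y) \<circ> (\<lambda>x. (f x, g x)))"
    using assms unfolding topological_group_def
    by (intro continuous_map_compose[of _ "prod_topology T T"] continuous_map_pairedI) auto
  then show ?thesis by (simp add: o_def)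
qed

lemma continuous_map_inv:
  assumes "topological_group G T" "continuous_map S T f"
  shows "continuous_map S T (\<lambda>x. inv\<^bsub>G\<^esub> (f x))"
proof -
  have "continuous_map S T ((\<lambda>x. inv\<^bsub>G\<^esub> x) \<circ> f)"
    using assms unfolding topological_group_def by (intro continuous_map_compose[of _ T]) auto
  then show ?thesis by (simp add: o_def)
qed

section \<open>Isometries of the Urysohn space\<close>

text \<open>\<open>R_small\<close> supplies errors in \<open>R\<close> below any tolerance;
  \<open>R_unbounded\<close> supplies the radii of the subgroups and the error for transitivity;
  \<open>R_countable\<close> makes the finitely supported points countable.\<close>

locale urysohn_space =
  fixes R :: "real set"
  assumes R_pos: "R \<subseteq> {0<..}" and R_countable: "countable R"
    and R_unbounded: "\<And>t. \<exists>r\<in>R. t \<le> r" and R_small: "\<And>e. e > 0 \<Longrightarrow> \<exists>r\<in>R. r < e"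
begin

abbreviation X :: "(real \<Rightarrow> nat) set" where "X \<equiv> urysohn R"
abbreviation d :: "(real \<Rightarrow> nat) \<Rightarrow> (real \<Rightarrow> nat) \<Rightarrow> real" where "d \<equiv> urysohn_dist R"
abbreviation G :: "((real \<Rightarrow> nat) \<Rightarrow> real \<Rightarrow> nat) monoid" where "G \<equiv> Iso X d"
abbreviation T :: "((real \<Rightarrow> nat) \<Rightarrow> real \<Rightarrow> nat) topology" where "T \<equiv> Iso_topology X d"

sublocale Metric_space X d by (rule Metric_space_urysohn[OF R_pos])

sublocale G: group G by (rule group_Iso)

lemma urysohn_ext: "x \<in> X \<Longrightarrow> x \<in> extensional R"
  unfolding urysohn_def by (auto simp: PiE_def)

lemma urysohn_finite: "x \<in> X \<Longrightarrow> r > 0 \<Longrightarrow> finite {s \<in> R. s > r \<and> x s \<noteq> 0}"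
  unfolding urysohn_def by blast

lemma urysohnI:
  "x \<in> extensional R \<Longrightarrow> (\<And>r. r > 0 \<Longrightarrow> finite {s \<in> R. s > r \<and> x s \<noteq> 0}) \<Longrightarrow> x \<in> X"
  unfolding urysohn_def by (auto simp: PiE_def)

lemma urysohn_eqI: "x \<in> X \<Longrightarrow> y \<in> X \<Longrightarrow> (\<And>s. s \<in> R \<Longrightarrow> x s = y s) \<Longrightarrow> x = y"
  using extensionalityI[OF urysohn_ext urysohn_ext] by blast

lemma dist_in_R: "x \<in> X \<Longrightarrow> y \<in> X \<Longrightarrow> x \<noteq> y \<Longrightarrow> d x y \<in> R"
  using urysohn_dist_attained(1)[OF R_pos] by blast

lemma dist_le_iff:
  assumes "x \<in> X" "y \<in> X" "0 \<le> t"
  shows "d x y \<le> t \<longleftrightarrow> (\<forall>s\<in>R. t < s \<longrightarrow> x s = y s)"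
proof (cases "x = y")
  case True
  then show ?thesis using assms by simp
next
  case False
  note att = urysohn_dist_attained[OF R_pos assms(1,2) False]
  show ?thesis
  proof
    assume "\<forall>s\<in>R. t < s \<longrightarrow> x s = y s"
    with att(1,2) show "d x y \<le> t" using not_le by blast
  next
    assume "d x y \<le> t"
    then have "\<not> t < s" if "s \<in> R" "x s \<noteq> y s" for s using att(3)[OF that] by linarith
    then show "\<forall>s\<in>R. t < s \<longrightarrow> x s = y s" by blast
  qed
qed

lemma dist_less_iff:
  assumes "x \<in> X" "y \<in> X" "0 < t"
  shows "d x y < t \<longleftrightarrow> (\<forall>s\<in>R. t \<le> s \<longrightarrow> x s = y s)"
proof (cases "x = y")
  case True
  then show ?thesis using assms by simp
next
  case False
  note att = urysohn_dist_attained[OF R_pos assms(1,2) False]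
  show ?thesis
  proof
    assume "\<forall>s\<in>R. t \<le> s \<longrightarrow> x s = y s"
    with att(1,2) show "d x y < t" using not_le by blast
  next
    assume "d x y < t"
    then have "\<not> t \<le> s" if "s \<in> R" "x s \<noteq> y s" for s using att(3)[OF that] by linarith
    then show "\<forall>s\<in>R. t \<le> s \<longrightarrow> x s = y s" by blast
  qed
qed

lemma dist_eqI:
  "x \<in> X \<Longrightarrow> y \<in> X \<Longrightarrow> r \<in> R \<Longrightarrow> x r \<noteq> y r \<Longrightarrow> (\<And>s. s \<in> R \<Longrightarrow> r < s \<Longrightarrow> x s = y s) \<Longrightarrow> d x y = r"
  by (rule urysohn_dist_eqI) (auto simp: not_le[symmetric])

lemma ultra: "x \<in> X \<Longrightarrow> y \<in> X \<Longrightarrow> z \<in> X \<Longrightarrow> d x z \<le> max (d x y) (d y z)"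
  by (rule urysohn_dist_ultrametric[OF R_pos])

lemma ultra_le: "x \<in> X \<Longrightarrow> y \<in> X \<Longrightarrow> z \<in> X \<Longrightarrow> d x y \<le> t \<Longrightarrow> d y z \<le> t \<Longrightarrow> d x z \<le> t"
  using ultra[of x y z] by linarith

lemma ultra_less: "x \<in> X \<Longrightarrow> y \<in> X \<Longrightarrow> z \<in> X \<Longrightarrow> d x y < t \<Longrightarrow> d y z < t \<Longrightarrow> d x z < t"
  using ultra[of x y z] by linarith

text \<open>The isosceles principle: the two longest sides of an ultrametric triangle are
  equal.\<close>

lemma dist_cong:
  assumes "x \<in> X" "x' \<in> X" "y \<in> X" "d x x' < d x y"
  shows "d x' y = d x y"
  using ultra[of x x' y] ultra[of x' x y] assms commute[of x x'] by linarith

lemma carrier_Iso: "carrier G = {f \<in> Bij X. \<forall>x\<in>X. \<forall>y\<in>X. d (f x) (f y) = d x y}"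
  unfolding Iso_def by simp

lemma iso_Bij: "g \<in> carrier G \<Longrightarrow> g \<in> Bij X"
  unfolding carrier_Iso by simp

lemma iso_closed: "g \<in> carrier G \<Longrightarrow> x \<in> X \<Longrightarrow> g x \<in> X"
  using Bij_imp_funcset[OF iso_Bij] by blast

lemma iso_dist: "g \<in> carrier G \<Longrightarrow> x \<in> X \<Longrightarrow> y \<in> X \<Longrightarrow> d (g x) (g y) = d x y"
  unfolding carrier_Iso by blast

lemma iso_mult: "g \<in> carrier G \<Longrightarrow> h \<in> carrier G \<Longrightarrow> g \<otimes>\<^bsub>G\<^esub> h = compose X g h"
proof -
  assume "g \<in> carrier G" "h \<in> carrier G"
  then have "g \<in> Bij X" "h \<in> Bij X" by (simp_all only: iso_Bij)
  moreover have "g \<otimes>\<^bsub>G\<^esub> h = g \<otimes>\<^bsub>BijGroup X\<^esub> h"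
    unfolding Iso_def by simp
  ultimately show ?thesis unfolding BijGroup_def by simp
qed

lemma iso_mult_apply [simp]: "g \<in> carrier G \<Longrightarrow> h \<in> carrier G \<Longrightarrow> x \<in> X \<Longrightarrow> (g \<otimes>\<^bsub>G\<^esub> h) x = g (h x)"
  by (simp add: iso_mult compose_eq)

lemma iso_one: "\<one>\<^bsub>G\<^esub> = (\<lambda>x\<in>X. x)"
  unfolding Iso_def BijGroup_def by simp

lemma iso_one_apply [simp]: "x \<in> X \<Longrightarrow> \<one>\<^bsub>G\<^esub> x = x"
  by (simp add: iso_one)

lemma iso_inv_apply [simp]:
  assumes "g \<in> carrier G" "x \<in> X"
  shows "(inv\<^bsub>G\<^esub> g) (g x) = x" "g ((inv\<^bsub>G\<^esub> g) x) = x"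
  using assms iso_mult_apply[of "inv\<^bsub>G\<^esub> g" g x] iso_mult_apply[of g "inv\<^bsub>G\<^esub> g" x] by auto

lemma iso_eqI:
  assumes "g \<in> carrier G" "h \<in> carrier G" "\<And>x. x \<in> X \<Longrightarrow> g x = h x"
  shows "g = h"
  using assms extensionalityI[of g X h] iso_Bij Bij_imp_extensional by blast

section \<open>Ball swaps and homogeneity\<close>

lemma isoI:
  assumes closed: "\<And>x. x \<in> X \<Longrightarrow> f x \<in> X" and dist: "\<And>x y. x \<in> X \<Longrightarrow> y \<in> X \<Longrightarrow> d (f x) (f y) = d x y"
    and surj: "\<And>y. y \<in> X \<Longrightarrow> \<exists>x\<in>X. f x = y"
  shows "restrict f X \<in> carrier G"
proof -
  have "inj_on f X"
    using dist closed by (intro inj_onI) (metis zero)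
  moreover have "f ` X = X" using closed surj by (auto simp: image_iff)
  ultimately show ?thesis
    unfolding carrier_Iso Bij_def by (simp add: bij_betw_def inj_on_restrict_eq dist)
qed

text \<open>The inequality at \<open>f x\<close> and \<open>f y\<close> is the converse inequality
  at \<open>x\<close> and \<open>y\<close>, and an involution is surjective.\<close>

lemma isoI_involution:
  assumes closed: "\<And>x. x \<in> X \<Longrightarrow> f x \<in> X" and dist: "\<And>x y. x \<in> X \<Longrightarrow> y \<in> X \<Longrightarrow> d (f x) (f y) \<le> d x y"
    and inv: "\<And>x. x \<in> X \<Longrightarrow> f (f x) = x"
  shows "restrict f X \<in> carrier G"
proof (rule isoI)
  fix x y assume "x \<in> X" "y \<in> X"
  then show "d (f x) (f y) = d x y"
    using dist[of x y] dist[of "f x" "f y"] closed inv by auto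
qed (use closed inv in blast)+

text \<open>A transposition in every coordinate takes \<open>x\<close> to \<open>x'\<close>, is an
  involution, and creates no values besides those of \<open>x\<close>, \<open>x'\<close> and
  \<open>y\<close>. The last point keeps finite boxes invariant.\<close>

definition twist :: "(real \<Rightarrow> nat) \<Rightarrow> (real \<Rightarrow> nat) \<Rightarrow> (real \<Rightarrow> nat) \<Rightarrow> real \<Rightarrow> nat" where
  "twist x x' y = (\<lambda>s\<in>R. Transposition.transpose (x s) (x' s) (y s))"

lemma twist_closed:
  assumes "x \<in> X" "x' \<in> X" "y \<in> X"
  shows "twist x x' y \<in> X"
proof (rule urysohnI)
  fix r :: real assume r: "r > 0"
  have "{s \<in> R. s > r \<and> twist x x' y s \<noteq> 0} \<subseteq>
    {s \<in> R. s > r \<and> x s \<noteq> 0} \<union> {s \<in> R. s > r \<and> x' s \<noteq> 0} \<union> {s \<in> R. s > r \<and> y s \<noteq> 0}"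
    unfolding twist_def by (auto simp: Transposition.transpose_def)
  then show "finite {s \<in> R. s > r \<and> twist x x' y s \<noteq> 0}"
    using assms[THEN urysohn_finite, OF r] by (meson finite_UnI finite_subset)
qed (simp add: twist_def)

lemma twist_dist:
  assumes "x \<in> X" "x' \<in> X" "y \<in> X" "z \<in> X"
  shows "d (twist x x' y) (twist x x' z) = d y z"
proof -
  have "twist x x' y s \<noteq> twist x x' z s \<longleftrightarrow> y s \<noteq> z s" if "s \<in> R" for s
    using that unfolding twist_def by (simp add: inj_eq)
  then have "(\<lambda>s. s \<in> R \<and> twist x x' y s \<noteq> twist x x' z s) = (\<lambda>s. s \<in> R \<and> y s \<noteq> z s)"
    and "twist x x' y = twist x x' z \<longleftrightarrow> y = z"
    using assms twist_closed urysohn_eqI[of y z] urysohn_eqI[of "twist x x' y" "twist x x' z"] by auto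
  then show ?thesis
    using assms twist_closed unfolding urysohn_dist_def by simp
qed

text \<open>Exchanges the open balls of radius \<open>d x x'\<close> around \<open>x\<close> and \<open>x'\<close> and fixes all other points.\<close>

definition ball_swap :: "(real \<Rightarrow> nat) \<Rightarrow> (real \<Rightarrow> nat) \<Rightarrow> (real \<Rightarrow> nat) \<Rightarrow> real \<Rightarrow> nat" where
  "ball_swap x x' = (\<lambda>y\<in>X. if d y x < d x x' \<or> d y x' < d x x' then twist x x' y else y)"

text \<open>A moved point travels at most \<open>d x x'\<close>, while every fixed point is at least
  that far from it. So no distance grows, and an involution with this property is an
  isometry.\<close>

lemma ball_swap:
  assumes x: "x \<in> X" "x' \<in> X"
  shows "ball_swap x x' \<in> carrier G"
    and "ball_swap x x' x = x'"
    and "\<And>y. y \<in> X \<Longrightarrow> d x x' \<le> d y x \<Longrightarrow> d x x' \<le> d y x' \<Longrightarrow> ball_swap x x' y = y"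
    and "\<And>y. y \<in> X \<Longrightarrow> ball_swap x x' (ball_swap x x' y) = y"
proof -
  define P where "P y \<longleftrightarrow> d y x < d x x' \<or> d y x' < d x x'" for y
  define t where "t = twist x x'"
  define f where "f y = (if P y then t y else y)" for y
  have tX: "t y \<in> X" if "y \<in> X" for y unfolding t_def using twist_closed x that by blast
  have fX: "f y \<in> X" if "y \<in> X" for y unfolding f_def using tX that by simp
  have near: "d (t y) x' < d x x'" if "y \<in> X" "d y x < d x x'" for y
  proof -
    have pos: "0 < d x x'" using that nonneg[of y x] by linarith
    show ?thesis
      using that(2) unfolding dist_less_iff[OF that(1) x(1) pos] dist_less_iff[OF tX[OF that(1)] x(2) pos]
      by (simp add: t_def twist_def)
  qed
  have near': "d (t y) x < d x x'" if "y \<in> X" "d y x' < d x x'" for y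
  proof -
    have pos: "0 < d x x'" using that nonneg[of y x'] by linarith
    show ?thesis
      using that(2) unfolding dist_less_iff[OF that(1) x(2) pos] dist_less_iff[OF tX[OF that(1)] x(1) pos]
      by (simp add: t_def twist_def)
  qed
  have Pt: "P (t y)" if "y \<in> X" "P y" for y using near near' that unfolding P_def by blast
  have tt: "t (t y) = y" if "y \<in> X" for y
    by (rule urysohn_eqI[OF tX[OF tX[OF that]] that]) (simp add: t_def twist_def)
  have ff: "f (f y) = y" if "y \<in> X" for y unfolding f_def using that tt Pt by auto
  have move: "d (t y) y \<le> d x x'" if y: "y \<in> X" "P y" for y
  proof -
    consider "d y x < d x x'" "d (t y) x' < d x x'" | "d y x' < d x x'" "d (t y) x < d x x'"
      using near near' y unfolding P_def by blast
    then show ?thesis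
    proof cases
      case 1
      have "d x' y \<le> d x x'" by (rule ultra_le[of _ x]) (use 1 y x commute in auto)
      then show ?thesis using 1 y x tX by (intro ultra_le[of "t y" x' y]) auto
    next
      case 2
      have "d x y \<le> d x x'" by (rule ultra_le[of _ x']) (use 2 y x commute[of y x'] in auto)
      then show ?thesis using 2 y x tX by (intro ultra_le[of "t y" x y]) auto
    qed
  qed
  have far: "d x x' \<le> d y z" if "y \<in> X" "z \<in> X" "P y" "\<not> P z" for y z
    using ultra_less[of z y x "d x x'"] ultra_less[of z y x' "d x x'"] that x commute[of y z]
    unfolding P_def by (metis not_le)
  have mixed: "d (t y) z \<le> d y z" if "y \<in> X" "z \<in> X" "P y" "\<not> P z" for y z
    using ultra_le[of "t y" y z "d y z"] move[of y] far[of y z] that tX by auto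
  have dist: "d (f y) (f z) \<le> d y z" if "y \<in> X" "z \<in> X" for y z
  proof (cases "P y \<longleftrightarrow> P z")
    case True
    then show ?thesis using twist_dist[OF x that] unfolding f_def t_def by auto
  next
    case False
    then show ?thesis
      using mixed[of y z] mixed[of z y] that commute[of y z] commute[of y "t z"] unfolding f_def by auto
  qed
  have f: "ball_swap x x' = restrict f X"
    unfolding ball_swap_def f_def P_def t_def by auto
  show "ball_swap x x' \<in> carrier G" unfolding f by (rule isoI_involution[OF fX dist ff])
  show "ball_swap x x' (ball_swap x x' y) = y" if "y \<in> X" for y
    using that ff fX unfolding f by simp
  show "ball_swap x x' y = y" if "y \<in> X" "d x x' \<le> d y x" "d x x' \<le> d y x'" for y
    using that unfolding ball_swap_def by auto
  show "ball_swap x x' x = x'"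
  \<comment> \<open>For \<open>x = x'\<close> the radius is \<open>0\<close>, the condition in
    \<open>ball_swap\<close> never holds, and the map is the identity on \<open>X\<close>.\<close>
  proof (cases "x = x'")
    case True
    then show ?thesis using x nonneg unfolding ball_swap_def by (auto simp: less_le_not_le)
  next
    case False
    then have "0 < d x x'" using x by simp
    moreover have "t x = x'"
      by (rule urysohn_eqI[OF tX[OF x(1)] x(2)]) (simp add: t_def twist_def)
    ultimately show ?thesis using x unfolding f f_def P_def by simp
  qed
qed

text \<open>This makes ball swaps between points of \<open>Y\<close> preserve \<open>Y\<close>. The
  whole space has the property, and so do the finite boxes used for approximation.\<close>

definition twist_closed_set :: "(real \<Rightarrow> nat) set \<Rightarrow> bool" where
  "twist_closed_set Y \<longleftrightarrow> Y \<subseteq> X \<and> (\<forall>x\<in>Y. \<forall>x'\<in>Y. \<forall>y\<in>Y. twist x x' y \<in> Y)"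

text \<open>Induction on \<open>I\<close>: once \<open>g\<close> is right on the earlier points, a
  ball swap takes \<open>g (a i)\<close> to \<open>b i\<close> without disturbing them.\<close>

lemma homogeneous_in:
  assumes Y: "twist_closed_set Y" and "finite I"
    and "\<And>i. i \<in> I \<Longrightarrow> a i \<in> Y" "\<And>i. i \<in> I \<Longrightarrow> b i \<in> Y"
    and "\<And>i j. i \<in> I \<Longrightarrow> j \<in> I \<Longrightarrow> d (a i) (a j) = d (b i) (b j)"
  shows "\<exists>g\<in>carrier G. g ` Y = Y \<and> (\<forall>i\<in>I. g (a i) = b i)"
  using assms(2-)
proof (induction I)
  case empty
  have "\<one>\<^bsub>G\<^esub> ` Y = Y" using Y unfolding twist_closed_set_def by (auto simp: iso_one image_iff)
  then show ?case by blast
next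
  case (insert i I)
  have YX: "Y \<subseteq> X" using Y unfolding twist_closed_set_def by blast
  obtain g where g: "g \<in> carrier G" "g ` Y = Y" "\<And>j. j \<in> I \<Longrightarrow> g (a j) = b j"
    using insert by auto
  define x where "x = g (a i)"
  have Yx: "x \<in> Y" "b i \<in> Y" using g(2) insert.prems(1,2)[of i] unfolding x_def by auto
  then have xX: "x \<in> X" "b i \<in> X" using YX by auto
  note f = ball_swap[OF xX]
  define f where "f = ball_swap x (b i)"
  have fG: "f \<in> carrier G" unfolding f_def by (rule f(1))
  have fY: "f y \<in> Y" if "y \<in> Y" for y
    using that Y Yx YX unfolding f_def ball_swap_def twist_closed_set_def by auto
  have "f ` Y = Y"
  proof
    show "f ` Y \<subseteq> Y" using fY by auto
    show "Y \<subseteq> f ` Y"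
    proof
      fix y assume y: "y \<in> Y"
      then have "y = f (f y)" using f(4) YX unfolding f_def by auto
      then show "y \<in> f ` Y" using fY[OF y] by (rule image_eqI)
    qed
  qed
  moreover have "(f \<otimes>\<^bsub>G\<^esub> g) ` Y = f ` g ` Y"
    unfolding image_image using YX by (intro image_cong) (auto simp: fG g(1))
  ultimately have "(f \<otimes>\<^bsub>G\<^esub> g) ` Y = Y"
    using g(2) by simp
  moreover have "(f \<otimes>\<^bsub>G\<^esub> g) (a j) = b j" if j: "j \<in> insert i I" for j
  proof -
    have aX: "a j \<in> X" "b j \<in> X" "a i \<in> X" using insert.prems(1,2) YX j by auto
    have "f (g (a j)) = b j"
    proof (cases "j = i")
      case True
      then show ?thesis using f(2) unfolding f_def x_def by simp
    next
      case False
      then have j': "j \<in> I" "g (a j) = b j" using j g(3) by auto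
      have "d (b j) x = d (b j) (b i)"
        using insert.prems(3)[of j i] j' g(1) aX iso_dist[of g "a j" "a i"] unfolding x_def by simp
      \<comment> \<open>\<open>b j\<close> is equidistant from \<open>x\<close> and
        \<open>b i\<close>, so it cannot lie in either of the open balls that are exchanged.\<close>
      then have "d x (b i) \<le> d (b j) x" "d x (b i) \<le> d (b j) (b i)"
        using ultra[of x "b j" "b i"] xX aX commute[of x "b j"] by auto
      then show ?thesis using f(3)[of "b j"] aX j' unfolding f_def by simp
    qed
    then show ?thesis using fG g(1) aX by simp
  qed
  ultimately show ?case using fG g(1) by (intro bexI[of _ "f \<otimes>\<^bsub>G\<^esub> g"]) auto
qed

lemma homogeneous:
  assumes "finite I" "\<And>i. i \<in> I \<Longrightarrow> a i \<in> X" "\<And>i. i \<in> I \<Longrightarrow> b i \<in> X"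
    and "\<And>i j. i \<in> I \<Longrightarrow> j \<in> I \<Longrightarrow> d (a i) (a j) = d (b i) (b j)"
  shows "\<exists>g\<in>carrier G. \<forall>i\<in>I. g (a i) = b i"
proof -
  have "twist_closed_set X" unfolding twist_closed_set_def using twist_closed by blast
  then have "\<exists>g\<in>carrier G. g ` X = X \<and> (\<forall>i\<in>I. g (a i) = b i)"
    using assms by (rule homogeneous_in)
  then show ?thesis by blast
qed


section \<open>Amalgamation and finite approximation\<close>

lemma zero_in_urysohn: "(\<lambda>s\<in>R. 0) \<in> X"
  by (rule urysohnI) (simp_all cong: conj_cong)

text \<open>\<open>f\<close> is an ultrametric analogue of a Katetov function. The new point copies
  the coordinates of a nearest \<open>a k\<close> above \<open>r = f k\<close> and takes at
  \<open>r\<close> a value that no \<open>a i\<close> has; infinitely many values per coordinate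
  make this possible. Points with \<open>f i > r\<close> are settled by the isosceles principle
  through \<open>a k\<close>.\<close>

lemma one_point_extension:
  assumes I: "finite I" and a: "\<And>i. i \<in> I \<Longrightarrow> a i \<in> X" and f: "\<And>i. i \<in> I \<Longrightarrow> f i \<in> R"
    and tri1: "\<And>i j. i \<in> I \<Longrightarrow> j \<in> I \<Longrightarrow> d (a i) (a j) \<le> max (f i) (f j)"
    and tri2: "\<And>i j. i \<in> I \<Longrightarrow> j \<in> I \<Longrightarrow> f i \<le> max (d (a i) (a j)) (f j)"
  shows "\<exists>x\<in>X. \<forall>i\<in>I. d x (a i) = f i"
proof (cases "I = {}")
  case True
  then show ?thesis using zero_in_urysohn by blast
next
  case False
  then have "Min (f ` I) \<in> f ` I" using I by (intro Min_in) auto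
  then obtain k where k: "k \<in> I" "f k = Min (f ` I)" by auto
  define r where "r = f k"
  have r: "r \<in> R" "0 < r" using f[OF k(1)] R_pos unfolding r_def by auto
  have r_min: "r \<le> f i" if "i \<in> I" for i using k(2) that I unfolding r_def by auto
  obtain v :: nat where v: "v \<notin> (\<lambda>i. a i r) ` I"
    using ex_new_if_finite[OF infinite_UNIV_nat finite_imageI[OF I]] by blast
  define x where "x = (\<lambda>s\<in>R. if r < s then a k s else if s = r then v else 0)"
  have xX: "x \<in> X"
  proof (rule urysohnI)
    fix t :: real assume t: "t > 0"
    have "{s \<in> R. s > t \<and> x s \<noteq> 0} \<subseteq> insert r {s \<in> R. s > t \<and> a k s \<noteq> 0}"
      unfolding x_def by (auto split: if_splits)
    then show "finite {s \<in> R. s > t \<and> x s \<noteq> 0}"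
      using urysohn_finite[OF a[OF k(1)] t] by (meson finite_insert finite_subset)
  qed (simp add: x_def)
  have near: "d x (a i) = r" if i: "i \<in> I" "f i = r" for i
  proof (rule dist_eqI[OF xX a[OF i(1)] r(1)])
    show "x r \<noteq> a i r" using v i(1) r(1) unfolding x_def by auto
    fix s assume s: "s \<in> R" "r < s"
    have "d (a k) (a i) \<le> r" using tri1[OF k(1) i(1)] i(2) unfolding r_def by simp
    then have "a k s = a i s"
      using s r a i(1) k(1) by (simp add: dist_le_iff)
    then show "x s = a i s" using s unfolding x_def by simp
  qed
  have "d x (a i) = f i" if i: "i \<in> I" for i
  proof (cases "f i = r")
    case True
    then show ?thesis using near i by simp
  next
    case False
    then have lt: "r < f i" using r_min[OF i] by simp
    then have "d (a k) (a i) = f i"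
      using tri1[OF k(1) i] tri2[OF i k(1)] commute[of "a k" "a i"] unfolding r_def by linarith
    moreover have "d (a k) x = r" using near[OF k(1)] commute[of "a k" x] unfolding r_def by simp
    ultimately show ?thesis using dist_cong[of "a k" x "a i"] a k(1) i xX lt by simp
  qed
  then show ?thesis using xX by blast
qed

text \<open>The points of \<open>E\<close> are added one at a time by
  \<open>one_point_extension\<close>. Their type is free, so that \<open>E\<close> can be a disjoint
  sum carrying an abstract ultrametric \<open>\<delta>\<close>.\<close>

lemma isometric_extension:
  assumes E: "finite E" and C: "C \<subseteq> E"
    and sym: "\<And>x y. x \<in> E \<Longrightarrow> y \<in> E \<Longrightarrow> \<delta> x y = \<delta> y x" and refl: "\<And>x. x \<in> E \<Longrightarrow> \<delta> x x = 0"
    and inR: "\<And>x y. x \<in> E \<Longrightarrow> y \<in> E \<Longrightarrow> x \<noteq> y \<Longrightarrow> \<delta> x y \<in> R"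
    and tri: "\<And>x y z. x \<in> E \<Longrightarrow> y \<in> E \<Longrightarrow> z \<in> E \<Longrightarrow> \<delta> x z \<le> max (\<delta> x y) (\<delta> y z)"
    and e: "\<And>x. x \<in> C \<Longrightarrow> e x \<in> X" "\<And>x y. x \<in> C \<Longrightarrow> y \<in> C \<Longrightarrow> d (e x) (e y) = \<delta> x y"
  shows "\<exists>f. (\<forall>x\<in>C. f x = e x) \<and> (\<forall>x\<in>E. f x \<in> X) \<and> (\<forall>x\<in>E. \<forall>y\<in>E. d (f x) (f y) = \<delta> x y)"
proof -
  have "\<exists>f. (\<forall>x\<in>C. f x = e x) \<and> (\<forall>x\<in>C \<union> F. f x \<in> X) \<and> (\<forall>x\<in>C \<union> F. \<forall>y\<in>C \<union> F. d (f x) (f y) = \<delta> x y)"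
    if "finite F" "F \<subseteq> E" for F
    using that
  proof (induction F)
    case empty
    then show ?case using e by auto
  next
    case (insert x F)
    then obtain f where "\<forall>x\<in>C. f x = e x" "\<forall>x\<in>C \<union> F. f x \<in> X"
      "\<forall>x\<in>C \<union> F. \<forall>y\<in>C \<union> F. d (f x) (f y) = \<delta> x y"
      by auto
    note f = this[rule_format]
    have CF: "C \<union> F \<subseteq> E" "x \<in> E" using insert.prems C by auto
    show ?case
    proof (cases "x \<in> C \<union> F")
      case True
      then have "C \<union> insert x F = C \<union> F" by auto
      then show ?thesis using f by (intro exI[of _ f]) simp
    next
      case False
      have "\<exists>y\<in>X. \<forall>i\<in>C \<union> F. d y (f i) = \<delta> x i"
      proof (rule one_point_extension)
        show "finite (C \<union> F)" using E CF(1) by (rule finite_subset[rotated])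
        fix i assume i: "i \<in> C \<union> F"
        show "f i \<in> X" using f(2) i .
        show "\<delta> x i \<in> R" using inR[of x i] i CF False by auto
        fix j assume j: "j \<in> C \<union> F"
        have E': "i \<in> E" "j \<in> E" "x \<in> E" using i j CF by auto
        show "d (f i) (f j) \<le> max (\<delta> x i) (\<delta> x j)"
          using f(3)[OF i j] tri[of i x j] sym[of i x] E' by simp
        show "\<delta> x i \<le> max (d (f i) (f j)) (\<delta> x j)"
          using f(3)[OF i j] tri[of x j i] sym[of i j] E' by (simp add: max.commute)
      qed
      then obtain y where y: "y \<in> X" "\<And>i. i \<in> C \<union> F \<Longrightarrow> d y (f i) = \<delta> x i" by blast
      define f' where "f' = f(x := y)"
      have f'_old: "f' z = f z" if "z \<in> C \<union> F" for z using that False unfolding f'_def by auto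
      have f'_new: "f' x = y" unfolding f'_def by simp
      have eq: "C \<union> insert x F = insert x (C \<union> F)" by auto
      have "d (f' u) (f' v) = \<delta> u v" if uv: "u \<in> insert x (C \<union> F)" "v \<in> insert x (C \<union> F)" for u v
      proof -
        consider "u = x" "v = x" | "u = x" "v \<in> C \<union> F" | "u \<in> C \<union> F" "v = x" | "u \<in> C \<union> F" "v \<in> C \<union> F"
          using uv by blast
        then show ?thesis
        proof cases
          case 1
          then show ?thesis using y(1) refl[OF CF(2)] f'_new by simp
        next
          case 2
          then show ?thesis using y(2) f'_new f'_old by simp
        next
          case 3
          then show ?thesis using y(2)[of u] f'_new f'_old[of u] commute[of "f u" y] sym[of u x] CF by auto
        next
          case 4
          then show ?thesis using f(3) f'_old by simp
        qed
      qed
      moreover have "f' u \<in> X" if "u \<in> insert x (C \<union> F)" for u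
        using that y(1) f(2) f'_new f'_old by auto
      moreover have "f' u = e u" if "u \<in> C" for u using that f(1) f'_old by simp
      ultimately show ?thesis unfolding eq by (intro exI[of _ f']) simp
    qed
  qed
  from this[OF E order_refl] show ?thesis using C by (simp add: Un_absorb1)
qed

text \<open>\<open>w\<close> places a second copy of the test points so that
  \<open>d x (w y)\<close> is the amalgam distance \<open>m x y\<close>. Sending \<open>c\<close> to
  \<open>h1 i c\<close> and \<open>w c\<close> to \<open>w (h2 i c)\<close> is isometric once
  \<open>m\<close> is invariant under the pair \<open>h1 i\<close>, \<open>h2 i\<close>; homogeneity
  extends this partial map to \<open>h i\<close>.\<close>

lemma amalgamation:
  fixes h1 h2 p :: "'i \<Rightarrow> (real \<Rightarrow> nat) \<Rightarrow> real \<Rightarrow> nat"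
  assumes J: "finite J" and B: "finite B" "B \<noteq> {}" "B \<subseteq> X" and e: "e \<in> R"
    and p: "\<And>i. i \<in> J \<Longrightarrow> p i ` B = B"
    and h1: "\<And>i. i \<in> J \<Longrightarrow> h1 i \<in> carrier G" "\<And>i b. i \<in> J \<Longrightarrow> b \<in> B \<Longrightarrow> d (h1 i b) (p i b) \<le> e"
    and h2: "\<And>i. i \<in> J \<Longrightarrow> h2 i \<in> carrier G" "\<And>i b. i \<in> J \<Longrightarrow> b \<in> B \<Longrightarrow> d (h2 i b) (p i b) \<le> e"
    and C: "finite C" "C \<subseteq> X"
  shows "\<exists>w\<in>carrier G. \<exists>h. (\<forall>b\<in>B. d (w b) b \<le> e) \<and>
    (\<forall>i\<in>J. h i \<in> carrier G \<and> (\<forall>c\<in>C. h i c = h1 i c \<and> h i (w c) = w (h2 i c)))"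
proof -
  have e0: "0 < e" using e R_pos by auto
  define m where "m x y = Min ((\<lambda>b. max (max (d x b) (d b y)) e) ` B)" for x y
  have m_le: "m x y \<le> t \<longleftrightarrow> (\<exists>b\<in>B. d x b \<le> t \<and> d b y \<le> t \<and> e \<le> t)" for x y t
    unfolding m_def using B(1,2) by (simp add: Min_le_iff) 
  have m_wit: "\<exists>b\<in>B. d x b \<le> m x y \<and> d b y \<le> m x y" for x y
    using m_le[of x y "m x y"] by auto
  have m_e: "e \<le> m x y" for x y using m_le[of x y "m x y"] by auto
  \<comment> \<open>The floor \<open>e\<close> also excludes the value \<open>0\<close>: distinct
    points of the disjoint sum, even two copies of one \<open>b\<close>, need a distance in
    \<open>R\<close>.\<close>
  have m_R: "m x y \<in> R" if "x \<in> X" "y \<in> X" for x y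
  proof -
    have "m x y \<in> (\<lambda>b. max (max (d x b) (d b y)) e) ` B"
      unfolding m_def using B(1,2) by (intro Min_in) auto
    then obtain b where b: "b \<in> B" "m x y = max (max (d x b) (d b y)) e" by blast
    have "d x b = 0 \<or> d x b \<in> R" "d b y = 0 \<or> d b y \<in> R"
      using dist_in_R[of x b] dist_in_R[of b y] zero[of x b] zero[of b y] that b(1) B(3) by blast+
    then show ?thesis using b(2) e e0 by (auto simp: max_def)
  qed
  \<comment> \<open>The triangle inequalities of the disjoint sum that involve both copies, sorted
    by where the three points lie.\<close>
  have m_left: "m x z \<le> max (d x y) (m y z)" if X: "x \<in> X" "y \<in> X" "z \<in> X" for x y z
  proof -
    obtain b where b: "b \<in> B" "d y b \<le> m y z" "d b z \<le> m y z" using m_wit by blast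
    show ?thesis unfolding m_le
      using b X B(3) ultra[of x y b] m_e[of y z] by (intro bexI[of _ b]) auto
  qed
  have m_right: "m x z \<le> max (m x y) (d y z)" if X: "x \<in> X" "y \<in> X" "z \<in> X" for x y z
  proof -
    obtain b where b: "b \<in> B" "d x b \<le> m x y" "d b y \<le> m x y" using m_wit by blast
    show ?thesis unfolding m_le
      using b X B(3) ultra[of b y z] m_e[of x y] by (intro bexI[of _ b]) auto
  qed
  have m_left': "m z x \<le> max (m y x) (d y z)" if "x \<in> X" "y \<in> X" "z \<in> X" for x y z
    using m_left[of z y x] that commute[of y z] by linarith
  have m_right': "m y x \<le> max (d x z) (m y z)" if "x \<in> X" "y \<in> X" "z \<in> X" for x y z
    using m_right[of y z x] that commute[of x z] by linarith
  have m_dist1: "d x z \<le> max (m x y) (m z y)" if X: "x \<in> X" "y \<in> X" "z \<in> X" for x y z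
  proof -
    obtain b where b: "b \<in> B" "d x b \<le> m x y" "d b y \<le> m x y" using m_wit by blast
    obtain b' where b': "b' \<in> B" "d z b' \<le> m z y" "d b' y \<le> m z y" using m_wit by blast
    have "b \<in> X" "b' \<in> X" using b(1) b'(1) B(3) by auto
    then show ?thesis
      using b b' ultra[OF X(1) _ X(2), of b] ultra[OF X] ultra[OF X(3) _ X(2), of b'] commute[of y z] by linarith
  qed
  have m_dist2: "d x z \<le> max (m y x) (m y z)" if X: "x \<in> X" "y \<in> X" "z \<in> X" for x y z
  proof -
    obtain b where b: "b \<in> B" "d y b \<le> m y x" "d b x \<le> m y x" using m_wit by blast
    obtain b' where b': "b' \<in> B" "d y b' \<le> m y z" "d b' z \<le> m y z" using m_wit by blast
    have "b \<in> X" "b' \<in> X" using b(1) b'(1) B(3) by auto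
    then show ?thesis
      using b b' ultra[OF X(2) _ X(1), of b] ultra[OF X] ultra[OF X(2) _ X(3), of b'] commute[of y x] by linarith
  qed
  \<comment> \<open>A witness \<open>b\<close> is exchanged for \<open>p i b\<close>, at a cost of
    at most \<open>e\<close>, which never exceeds \<open>m\<close>. The converse pulls a witness
    back along \<open>p i\<close>, which is possible because \<open>p i\<close> maps
    \<open>B\<close> onto itself.\<close>
  have m_inv: "m (h1 i x) (h2 i y) = m x y" if i: "i \<in> J" and X: "x \<in> X" "y \<in> X" for i x y
  proof (rule antisym)
    note G = h1(1)[OF i] h2(1)[OF i]
    note GX = iso_closed[OF G(1)] iso_closed[OF G(2)]
    have n1: "d (h1 i b) (p i b) \<le> t" "d (p i b) (h1 i b) \<le> t"
      and n2: "d (h2 i b) (p i b) \<le> t" "d (p i b) (h2 i b) \<le> t" if "b \<in> B" "e \<le> t" for b t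
      using h1(2)[OF i that(1)] h2(2)[OF i that(1)] that(2) commute[of "p i b"] by auto
    obtain b where b: "b \<in> B" "d x b \<le> m x y" "d b y \<le> m x y" using m_wit by blast
    then have bX: "b \<in> X" "p i b \<in> X" "p i b \<in> B" using B(3) p[OF i] by auto
    have "d (h1 i x) (p i b) \<le> m x y"
      by (rule ultra_le[OF _ _ _ _ n1(1)[OF b(1) m_e]]) (use b bX X GX iso_dist[OF G(1)] in auto)
    moreover have "d (p i b) (h2 i y) \<le> m x y"
      by (rule ultra_le[OF _ _ _ n2(2)[OF b(1) m_e]]) (use b bX X GX iso_dist[OF G(2)] in auto)
    ultimately show "m (h1 i x) (h2 i y) \<le> m x y" unfolding m_le[of "h1 i x"] using bX(3) m_e by blast
    obtain c where c: "c \<in> B" "d (h1 i x) c \<le> m (h1 i x) (h2 i y)" "d c (h2 i y) \<le> m (h1 i x) (h2 i y)"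
      using m_wit by blast
    obtain b' where b': "b' \<in> B" "c = p i b'" using p[OF i] c(1) by blast
    then have b'X: "b' \<in> X" "p i b' \<in> X" using B(3) c(1) by auto
    have "d (h1 i x) (h1 i b') \<le> m (h1 i x) (h2 i y)"
      by (rule ultra_le[OF _ _ _ _ n1(2)[OF b'(1) m_e]]) (use b' c b'X X GX in auto)
    moreover have "d (h2 i b') (h2 i y) \<le> m (h1 i x) (h2 i y)"
      by (rule ultra_le[OF _ _ _ n2(1)[OF b'(1) m_e]]) (use b' c b'X X GX in auto)
    ultimately show "m x y \<le> m (h1 i x) (h2 i y)"
      unfolding m_le[of x] using b'(1) b'X X iso_dist[OF G(1)] iso_dist[OF G(2)] m_e by auto
  qed
  \<comment> \<open>The images of \<open>C\<close> are included because the distances between images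
    must be governed by the amalgam too.\<close>
  define K where "K = B \<union> C \<union> (\<Union>i\<in>J. h1 i ` C) \<union> (\<Union>i\<in>J. h2 i ` C)"
  have K: "finite K" "K \<subseteq> X"
    unfolding K_def using B C J iso_closed h1(1) h2(1) by auto
  define \<delta> where "\<delta> u v = (case u of Inl x \<Rightarrow> (case v of Inl y \<Rightarrow> d x y | Inr y \<Rightarrow> m x y)
    | Inr x \<Rightarrow> (case v of Inl y \<Rightarrow> m y x | Inr y \<Rightarrow> d x y))" for u v
  \<comment> \<open>The first copy stays where it is in \<open>X\<close>; only the second copy has
    to be found.\<close>
  have "\<exists>f. (\<forall>x\<in>Inl ` K. f x = case_sum id id x) \<and> (\<forall>x\<in>K <+> K. f x \<in> X) \<and>
    (\<forall>x\<in>K <+> K. \<forall>y\<in>K <+> K. d (f x) (f y) = \<delta> x y)"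
  proof (rule isometric_extension)
    show "finite (K <+> K)" "Inl ` K \<subseteq> K <+> K" using K(1) by auto
    show "\<delta> x z \<le> max (\<delta> x y) (\<delta> y z)" if "x \<in> K <+> K" "y \<in> K <+> K" "z \<in> K <+> K" for x y z
      using that K(2) unfolding \<delta>_def
      by (auto simp: subset_iff intro: ultra m_left m_left' m_right m_right' m_dist1 m_dist2 split: sum.split) 
    show "\<delta> x y \<in> R" if "x \<in> K <+> K" "y \<in> K <+> K" "x \<noteq> y" for x y
      using that K(2) unfolding \<delta>_def by (auto simp: subset_iff intro!: m_R) (metis dist_in_R)+
  qed (use K(2) in \<open>auto simp: \<delta>_def commute subset_iff\<close>)
  then obtain f where f0: "\<And>x. x \<in> Inl ` K \<Longrightarrow> f x = case_sum id id x" "\<And>x. x \<in> K <+> K \<Longrightarrow> f x \<in> X"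
    "\<And>x y. x \<in> K <+> K \<Longrightarrow> y \<in> K <+> K \<Longrightarrow> d (f x) (f y) = \<delta> x y"
    by metis
  have f: "f (Inl x) = x" "f (Inr x) \<in> X" if "x \<in> K" for x
    using f0(1)[of "Inl x"] f0(2)[of "Inr x"] that by auto
  have f_dist: "d (f (Inr x)) (f (Inr y)) = d x y" "d (f (Inl x)) (f (Inr y)) = m x y"
    if "x \<in> K" "y \<in> K" for x y
    using f0(3)[of "Inr x" "Inr y"] f0(3)[of "Inl x" "Inr y"] that unfolding \<delta>_def by auto
  have "\<exists>w\<in>carrier G. \<forall>x\<in>K. w x = f (Inr x)"
    by (rule homogeneous) (use K f(2) f_dist(1) in auto)
  then obtain w where w: "w \<in> carrier G" "\<And>x. x \<in> K \<Longrightarrow> w x = f (Inr x)" by blast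
  have wm: "d x (w y) = m x y" if "x \<in> K" "y \<in> K" for x y
    using f(1) f_dist(2) w(2) that by metis
  \<comment> \<open>Indexing by a disjoint sum treats both copies at once; equality of the cross
    distances is \<open>m_inv\<close>.\<close>
  have "\<exists>g\<in>carrier G. \<forall>u\<in>C <+> C. g (case_sum id w u) = case_sum (h1 i) (\<lambda>c. w (h2 i c)) u" if i: "i \<in> J" for i
  proof (rule homogeneous)
    note G = h1(1)[OF i] h2(1)[OF i]
    show "finite (C <+> C)" using C by simp
    show "case_sum id w u \<in> X" if "u \<in> C <+> C" for u
      using that C(2) iso_closed[OF w(1)] by auto
    show "case_sum (h1 i) (\<lambda>c. w (h2 i c)) u \<in> X" if "u \<in> C <+> C" for u
      using that C(2) iso_closed[OF w(1)] iso_closed[OF G(1)] iso_closed[OF G(2)] by auto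
    have cross: "d x (w y) = d (h1 i x) (w (h2 i y))" if "x \<in> C" "y \<in> C" for x y
    proof -
      have "x \<in> K" "y \<in> K" "h1 i x \<in> K" "h2 i y \<in> K" using that i unfolding K_def by auto
      then show ?thesis using wm m_inv[OF i] K(2) by (metis subset_iff)
    qed
    have cross': "d (w y) x = d (w (h2 i y)) (h1 i x)" if "x \<in> C" "y \<in> C" for x y
      using cross[OF that] commute[of "w y" x] commute[of "w (h2 i y)"] by simp
    have same1: "d x y = d (h1 i x) (h1 i y)" if "x \<in> C" "y \<in> C" for x y
      by (rule iso_dist[OF G(1), symmetric]) (use that C(2) in auto)
    have same2: "d (w x) (w y) = d (w (h2 i x)) (w (h2 i y))" if "x \<in> C" "y \<in> C" for x y
    proof -
      have "x \<in> X" "y \<in> X" using that C(2) by auto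
      then show ?thesis
        using iso_dist[OF w(1)] iso_dist[OF G(2)] iso_closed[OF G(2)] by metis
    qed
    fix u v assume "u \<in> C <+> C" "v \<in> C <+> C"
    then show "d (case_sum id w u) (case_sum id w v) =
        d (case_sum (h1 i) (\<lambda>c. w (h2 i c)) u) (case_sum (h1 i) (\<lambda>c. w (h2 i c)) v)"
      by (elim PlusE; hypsubst; simp only: sum.case id_apply) (rule same1 cross cross' same2; assumption)+
  qed
  then obtain h where h: "\<And>i. i \<in> J \<Longrightarrow> h i \<in> carrier G"
    "\<And>i u. i \<in> J \<Longrightarrow> u \<in> C <+> C \<Longrightarrow> h i (case_sum id w u) = case_sum (h1 i) (\<lambda>c. w (h2 i c)) u"
    by metis
  have "h i c = h1 i c" "h i (w c) = w (h2 i c)" if "i \<in> J" "c \<in> C" for i c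
    using h(2)[OF that(1), of "Inl c"] h(2)[OF that(1), of "Inr c"] that(2) by auto
  moreover have "d (w b) b \<le> e" if "b \<in> B" for b
  proof -
    have b: "b \<in> K" "b \<in> X" using that B(3) unfolding K_def by auto
    have "d (w b) b = m b b" using wm[OF b(1) b(1)] commute[of b "w b"] by simp
    also have "\<dots> \<le> e" unfolding m_le using that b e0 by (intro bexI[of _ b]) auto
    finally show ?thesis .
  qed
  ultimately show ?thesis using w(1) h(1) by blast
qed

section \<open>Finite homogeneous sets and truncation\<close>

definition finite_box :: "real set \<Rightarrow> nat \<Rightarrow> (real \<Rightarrow> nat) set" where
  "finite_box S N = {x \<in> extensional R. \<forall>s\<in>R. x s < N \<and> (s \<notin> S \<longrightarrow> x s = 0)}"

text \<open>Partial isometries of an arbitrary finite set need not extend to isometries preserving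
  it. A box works because twists introduce no new values and leave the coordinates outside
  \<open>S\<close> at zero.\<close>

lemma finite_box:
  assumes S: "finite S" and N: "0 < N"
  shows "finite (finite_box S N)" "finite_box S N \<noteq> {}" "twist_closed_set (finite_box S N)"
proof -
  have sub: "finite_box S N \<subseteq> X"
  proof
    fix x assume x: "x \<in> finite_box S N"
    have "{s \<in> R. s > r \<and> x s \<noteq> 0} \<subseteq> S" for r using x unfolding finite_box_def by auto
    then show "x \<in> X" using x S unfolding finite_box_def by (intro urysohnI) (auto intro: finite_subset)
  qed
  have "inj_on (\<lambda>x. restrict x (S \<inter> R)) (finite_box S N)"
  proof (rule inj_onI)
    fix x y assume xy: "x \<in> finite_box S N" "y \<in> finite_box S N" and eq: "restrict x (S \<inter> R) = restrict y (S \<inter> R)"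
    have "x s = y s" if "s \<in> R" for s
      using fun_cong[OF eq, of s] xy that unfolding finite_box_def by (cases "s \<in> S") auto
    then show "x = y" using xy sub by (intro urysohn_eqI) auto
  qed
  moreover have "(\<lambda>x. restrict x (S \<inter> R)) ` finite_box S N \<subseteq> S \<inter> R \<rightarrow>\<^sub>E {..<N}"
    unfolding finite_box_def by (auto intro!: restrict_PiE_iff[THEN iffD2])
  moreover have "finite (S \<inter> R \<rightarrow>\<^sub>E {..<N})" using S by (intro finite_PiE) auto
  ultimately show "finite (finite_box S N)" by (meson finite_imageD finite_subset)
  have "(\<lambda>s\<in>R. 0) \<in> finite_box S N" unfolding finite_box_def using N by auto
  then show "finite_box S N \<noteq> {}" by blast
  show "twist_closed_set (finite_box S N)"
    using sub unfolding twist_closed_set_def finite_box_def twist_def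
    by (auto simp: Transposition.transpose_def)
qed

text \<open>A canonical representative of the closed ball of radius \<open>t\<close> around
  \<open>x\<close>: points at distance at most \<open>t\<close> have the same truncation.\<close>

definition trunc :: "real \<Rightarrow> (real \<Rightarrow> nat) \<Rightarrow> real \<Rightarrow> nat" where
  "trunc t x = (\<lambda>s\<in>R. if t < s then x s else 0)"

lemma finite_support_trunc: "x \<in> X \<Longrightarrow> 0 < t \<Longrightarrow> finite {s \<in> R. trunc t x s \<noteq> 0}"
  by (rule finite_subset[OF _ urysohn_finite[of x t]]) (auto simp: trunc_def)

lemma trunc_closed: "x \<in> X \<Longrightarrow> 0 < t \<Longrightarrow> trunc t x \<in> X"
  using finite_support_trunc[of x t]
  by (intro urysohnI) (auto simp: trunc_def elim: finite_subset[rotated])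

lemma dist_trunc: "x \<in> X \<Longrightarrow> 0 < t \<Longrightarrow> d x (trunc t x) \<le> t"
  using trunc_closed by (subst dist_le_iff) (auto simp: trunc_def)

text \<open>The value depends only on \<open>d x y\<close> and \<open>t\<close>. Hence for an
  isometry \<open>g\<close> the assignment of \<open>trunc t (g a)\<close> to
  \<open>trunc t a\<close> is a partial isometry.\<close>

lemma dist_trunc_trunc:
  assumes x: "x \<in> X" "y \<in> X" and t: "0 < t"
  shows "d (trunc t x) (trunc t y) = (if d x y \<le> t then 0 else d x y)"
proof (cases "d x y \<le> t")
  case True
  then have "trunc t x = trunc t y"
    using x t unfolding trunc_def by (auto simp: dist_le_iff)
  then show ?thesis using True trunc_closed x t by simp
next
  case False
  then have "d (trunc t x) y = d x y"
    using dist_cong[of x "trunc t x" y] dist_trunc[OF x(1) t] trunc_closed x t by simp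
  then show ?thesis
    using False dist_cong[of y "trunc t y" "trunc t x"] dist_trunc[OF x(2) t] trunc_closed x t
      commute[of y "trunc t x"] commute[of "trunc t y" "trunc t x"] by simp
qed

text \<open>
  All points are truncated into a \<^const>\<open>finite_box\<close>, whose partial isometries extend to isometries
  preserving the box.
\<close>

lemma finite_approximation:
  assumes J: "finite J" and g: "\<And>i. i \<in> J \<Longrightarrow> g i \<in> carrier G"
    and A: "finite A" "A \<subseteq> X" and t: "0 < t"
  shows "\<exists>B p. finite B \<and> B \<noteq> {} \<and> B \<subseteq> X \<and>
    (\<forall>i\<in>J. p i \<in> carrier G \<and> p i ` B = B \<and> (\<forall>a\<in>A. d (p i a) (g i a) \<le> t)) \<and>
    (\<forall>a\<in>A. \<exists>b\<in>B. d a b \<le> t)"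
proof -
  define A' where "A' = trunc t ` (A \<union> (\<Union>i\<in>J. g i ` A))"
  have gX: "g i a \<in> X" if "i \<in> J" "a \<in> A" for i a using iso_closed g that A(2) by blast
  have A': "finite A'" unfolding A'_def using A J by auto
  have supp: "finite {s \<in> R. x s \<noteq> 0}" if "x \<in> A'" for x
    using that finite_support_trunc t gX A(2) unfolding A'_def by auto
  define S where "S = (\<Union>x\<in>A'. {s \<in> R. x s \<noteq> 0})"
  have S: "finite S" unfolding S_def using A' supp by blast
  \<comment> \<open>\<open>N\<close> exceeds every coordinate value that occurs; the inserted
    \<open>0\<close> keeps \<open>Max\<close> meaningful when there are none.\<close>
  define N where "N = Suc (Max (insert 0 ((\<lambda>(x, s). x s) ` (A' \<times> S))))"
  define B where "B = finite_box S N"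
  have N: "0 < N" unfolding N_def by simp
  note box = finite_box[OF S N, folded B_def]
  have A'B: "A' \<subseteq> B"
  proof
    fix x assume x: "x \<in> A'"
    have "x s < N" if "s \<in> S" for s
      unfolding N_def less_Suc_eq_le using A' S x that by (intro Max_ge) auto
    moreover have "x s = 0" if "s \<in> R" "s \<notin> S" for s using that x unfolding S_def by auto
    moreover have "x \<in> extensional R" using x unfolding A'_def trunc_def by auto
    ultimately show "x \<in> B" unfolding B_def finite_box_def using N by auto metis
  qed
  have BX: "B \<subseteq> X" using box(3) unfolding twist_closed_set_def by blast
  have "\<exists>p\<in>carrier G. p ` B = B \<and> (\<forall>a\<in>A. p (trunc t a) = trunc t (g i a))" if i: "i \<in> J" for i
  proof (rule homogeneous_in[OF box(3) A(1)])
    show "trunc t a \<in> B" "trunc t (g i a) \<in> B" if "a \<in> A" for a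
      using that i A'B unfolding A'_def by auto
    show "d (trunc t a) (trunc t b) = d (trunc t (g i a)) (trunc t (g i b))" if "a \<in> A" "b \<in> A" for a b
    proof -
      have "a \<in> X" "b \<in> X" using that A(2) by auto
      then show ?thesis
        using dist_trunc_trunc[OF _ _ t] iso_dist[OF g[OF i]] iso_closed[OF g[OF i]] by simp
    qed
  qed
  then obtain p where p: "\<And>i. i \<in> J \<Longrightarrow> p i \<in> carrier G" "\<And>i. i \<in> J \<Longrightarrow> p i ` B = B"
    "\<And>i a. i \<in> J \<Longrightarrow> a \<in> A \<Longrightarrow> p i (trunc t a) = trunc t (g i a)"
    by metis
  have "d (p i a) (g i a) \<le> t" if i: "i \<in> J" and a: "a \<in> A" for i a
  proof (rule ultra_le[of _ "trunc t (g i a)"])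
    have aX: "a \<in> X" using a A(2) by blast
    show "p i a \<in> X" "trunc t (g i a) \<in> X" "g i a \<in> X"
      using iso_closed[OF p(1)[OF i] aX] gX[OF i a] trunc_closed t by auto
    show "d (p i a) (trunc t (g i a)) \<le> t"
      using p(3)[OF i a] iso_dist[OF p(1)[OF i] aX trunc_closed[OF aX t]] dist_trunc[OF aX t] by simp
    show "d (trunc t (g i a)) (g i a) \<le> t"
      using dist_trunc[OF gX[OF i a] t] by (simp add: commute)
  qed
  moreover have "\<exists>b\<in>B. d a b \<le> t" if "a \<in> A" for a
  proof
    show "trunc t a \<in> B" using that A'B unfolding A'_def by auto
    show "d a (trunc t a) \<le> t" using dist_trunc t that A(2) by auto
  qed
  ultimately show ?thesis using box(1,2) BX p(1,2) by (intro exI[of _ B] exI[of _ p]) simp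
qed

section \<open>The isometry group as a Polish group\<close>

lemma topspace_Iso: "topspace T = carrier G"
  unfolding Iso_topology_def carrier_Iso using Bij_imp_extensional Bij_imp_funcset
  by (fastforce simp: PiE_def)

lemma continuous_eval: "a \<in> X \<Longrightarrow> continuous_map T mtopology (\<lambda>g. g a)"
  unfolding Iso_topology_def
  by (intro continuous_map_from_subtopology continuous_map_product_projection)

lemma openin_Iso_ball:
  assumes "a \<in> X" "y \<in> X"
  shows "openin T {g \<in> carrier G. d (g a) y < t}"
proof -
  have "openin T {g \<in> topspace T. g a \<in> mball y t}"
    by (rule openin_continuous_map_preimage[OF continuous_eval[OF assms(1)] openin_mball])
  moreover have "{g \<in> topspace T. g a \<in> mball y t} = {g \<in> carrier G. d (g a) y < t}"
    using assms iso_closed commute by (auto simp: topspace_Iso)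
  ultimately show ?thesis by simp
qed

lemma Iso_neighbourhood:
  assumes V: "openin T V" and g: "g \<in> V"
  shows "\<exists>A t. finite A \<and> A \<subseteq> X \<and> 0 < t \<and> (\<forall>h\<in>carrier G. (\<forall>a\<in>A. d (h a) (g a) < t) \<longrightarrow> h \<in> V)"
proof -
  have gG: "g \<in> carrier G" using openin_subset[OF V] g topspace_Iso by auto
  obtain W where W: "openin (product_topology (\<lambda>_. mtopology) X) W" "V = W \<inter> carrier G"
    using V unfolding Iso_topology_def openin_subtopology by auto
  then obtain U where U: "finite {a \<in> X. U a \<noteq> X}" "\<forall>a\<in>X. openin mtopology (U a)"
    "g \<in> Pi\<^sub>E X U" "Pi\<^sub>E X U \<subseteq> W"
    using g unfolding openin_product_topology_alt by auto
  define A where "A = {a \<in> X. U a \<noteq> X}"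
  have "\<exists>r>0. mball (g a) r \<subseteq> U a" if a: "a \<in> X" for a
  proof -
    have "openin mtopology (U a)" "g a \<in> U a" using U(2,3) a by auto
    then show ?thesis unfolding openin_mtopology by blast
  qed
  then obtain r where r: "\<And>a. a \<in> X \<Longrightarrow> r a > 0" "\<And>a. a \<in> X \<Longrightarrow> mball (g a) (r a) \<subseteq> U a"
    by metis
  \<comment> \<open>The inserted \<open>1\<close> covers the case of empty \<open>A\<close>.\<close>
  define t where "t = Min (insert 1 (r ` A))"
  have A: "finite A" "A \<subseteq> X" using U(1) unfolding A_def by auto
  have "0 < t" unfolding t_def using A r(1) by (subst Min_gr_iff) auto
  moreover have "h \<in> V" if h: "h \<in> carrier G" "\<forall>a\<in>A. d (h a) (g a) < t" for h
  proof -
    have "h a \<in> U a" if a: "a \<in> X" for a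
    proof (cases "a \<in> A")
      case True
      have "t \<le> r a" unfolding t_def using A True by (intro Min_le) auto
      then have "h a \<in> mball (g a) (r a)"
        using h True a iso_closed[OF gG a] iso_closed[OF h(1) a] commute[of "h a" "g a"] by auto
      then show ?thesis using r(2)[OF a] by blast
    next
      case False
      then show ?thesis using a iso_closed[OF h(1) a] unfolding A_def by simp
    qed
    then have "h \<in> Pi\<^sub>E X U"
      using iso_Bij[OF h(1)] Bij_imp_extensional by (auto simp: PiE_def)
    then show ?thesis using U(4) W(2) h(1) by auto
  qed
  ultimately show ?thesis using A by blast
qed

lemma continuous_map_into_Iso:
  assumes "f \<in> topspace S \<rightarrow> carrier G" "\<And>a. a \<in> X \<Longrightarrow> continuous_map S mtopology (\<lambda>s. f s a)"
  shows "continuous_map S T f"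
proof -
  have "f s \<in> extensional X" if "s \<in> topspace S" for s
    using assms(1) that iso_Bij Bij_imp_extensional by blast
  then show ?thesis
    unfolding Iso_topology_def using assms
    by (auto simp: continuous_map_in_subtopology continuous_map_componentwise)
qed

lemma topological_group_Iso: "topological_group G T"
proof -
  have "continuous_map (prod_topology T T) T (\<lambda>(f, g). f \<otimes>\<^bsub>G\<^esub> g)"
  proof (rule continuous_map_into_Iso)
    fix a assume a: "a \<in> X"
    show "continuous_map (prod_topology T T) mtopology (\<lambda>s. (case s of (f, g) \<Rightarrow> f \<otimes>\<^bsub>G\<^esub> g) a)"
      unfolding continuous_map_to_metric
    proof (intro ballI allI impI)
      fix s and e :: real assume s: "s \<in> topspace (prod_topology T T)" and e: "e > 0"
      obtain f g where fg: "s = (f, g)" "f \<in> carrier G" "g \<in> carrier G"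
        using s by (auto simp: topspace_Iso)
      have ga: "g a \<in> X" "f (g a) \<in> X" using a fg iso_closed by auto
      define U where "U = {f' \<in> carrier G. d (f' (g a)) (f (g a)) < e} \<times> {g' \<in> carrier G. d (g' a) (g a) < e}"
      have "openin (prod_topology T T) U"
        unfolding U_def using openin_Iso_ball a ga by (simp add: openin_prod_Times_iff)
      moreover have "s \<in> U" unfolding U_def fg using fg ga e by simp
      moreover have "(case y of (f, g) \<Rightarrow> f \<otimes>\<^bsub>G\<^esub> g) a \<in> mball ((case s of (f, g) \<Rightarrow> f \<otimes>\<^bsub>G\<^esub> g) a) e"
        if "y \<in> U" for y
      proof -
        obtain f' g' where y: "y = (f', g')" "f' \<in> carrier G" "g' \<in> carrier G"
          "d (f' (g a)) (f (g a)) < e" "d (g' a) (g a) < e"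
          using \<open>y \<in> U\<close> unfolding U_def by auto
        have g'a: "g' a \<in> X" using y a iso_closed by auto
        have "d (f' (g' a)) (f (g a)) < e"
          by (rule ultra_less[of _ "f' (g a)"]) (use y ga g'a iso_closed iso_dist[OF y(2) g'a ga(1)] in auto)
        then show ?thesis
          using y fg a ga g'a iso_closed commute[of "f (g a)"] by simp
      qed
      ultimately show "\<exists>U. openin (prod_topology T T) U \<and> s \<in> U \<and>
          (\<forall>y\<in>U. (case y of (f, g) \<Rightarrow> f \<otimes>\<^bsub>G\<^esub> g) a \<in> mball ((case s of (f, g) \<Rightarrow> f \<otimes>\<^bsub>G\<^esub> g) a) e)"
        by blast
    qed
  qed (auto simp: topspace_Iso)
  moreover have "continuous_map T T (\<lambda>g. inv\<^bsub>G\<^esub> g)"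
  proof (rule continuous_map_into_Iso)
    fix a assume a: "a \<in> X"
    show "continuous_map T mtopology (\<lambda>g. (inv\<^bsub>G\<^esub> g) a)"
      unfolding continuous_map_to_metric
    proof (intro ballI allI impI)
      fix g and e :: real assume "g \<in> topspace T" and e: "e > 0"
      then have g: "g \<in> carrier G" by (simp add: topspace_Iso)
      \<comment> \<open>Closeness of the inverses of \<open>h\<close> and \<open>g\<close> at
        \<open>a\<close> is closeness of \<open>h\<close> and \<open>g\<close> at \<open>b\<close>,
        because \<open>h\<close> preserves distances.\<close>
      define b where "b = (inv\<^bsub>G\<^esub> g) a"
      have b: "b \<in> X" "g b = a" unfolding b_def using g a iso_closed by auto
      have "(inv\<^bsub>G\<^esub> h) a \<in> mball b e" if h: "h \<in> carrier G" "d (h b) a < e" for h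
      proof -
        have c: "(inv\<^bsub>G\<^esub> h) a \<in> X" "h ((inv\<^bsub>G\<^esub> h) a) = a" using h a iso_closed by auto
        have "d b ((inv\<^bsub>G\<^esub> h) a) = d (h b) a" using iso_dist[OF h(1) b(1) c(1)] c(2) by simp
        then show ?thesis using h b c by simp
      qed
      then show "\<exists>U. openin T U \<and> g \<in> U \<and> (\<forall>h\<in>U. (inv\<^bsub>G\<^esub> h) a \<in> mball ((inv\<^bsub>G\<^esub> g) a) e)"
        using openin_Iso_ball[OF b(1) a, of e] g b a e unfolding b_def[symmetric]
        by (intro exI[of _ "{h \<in> carrier G. d (h b) a < e}"]) simp
    qed
  qed (auto simp: topspace_Iso)
  ultimately show ?thesis
    unfolding topological_group_def using topspace_Iso group_Iso by blast
qed

section \<open>A countable dense set; second countability and completeness of the space\<close>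

definition D :: "(real \<Rightarrow> nat) set" where
  "D = {x \<in> X. finite {s \<in> R. x s \<noteq> 0}}"

lemma D_subset: "D \<subseteq> X" unfolding D_def by blast

lemma trunc_in_D: "x \<in> X \<Longrightarrow> 0 < t \<Longrightarrow> trunc t x \<in> D"
  unfolding D_def using trunc_closed finite_support_trunc by blast

text \<open>A point of \<open>D\<close> is determined by the finite set of its nonzero coordinates
  paired with their values.\<close>

lemma countable_D: "countable D"
proof -
  define \<phi> where "\<phi> x = {(s, x s) | s. s \<in> R \<and> x s \<noteq> 0}" for x :: "real \<Rightarrow> nat"
  have "inj_on \<phi> D"
  proof (rule inj_onI)
    fix x y assume xy: "x \<in> D" "y \<in> D" and eq: "\<phi> x = \<phi> y"
    have "x s = y s" if s: "s \<in> R" for s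
    proof -
      have *: "(s, v) \<in> \<phi> z \<longleftrightarrow> v = z s \<and> z s \<noteq> 0" for v z using s unfolding \<phi>_def by auto
      have "v = x s \<and> x s \<noteq> 0 \<longleftrightarrow> v = y s \<and> y s \<noteq> 0" for v using *[of v x] *[of v y] unfolding eq by blast
      then show ?thesis by metis
    qed
    then show "x = y" using xy D_subset by (intro urysohn_eqI) auto
  qed
  moreover have "\<phi> ` D \<subseteq> {A. finite A \<and> A \<subseteq> R \<times> UNIV}"
  proof
    fix A assume "A \<in> \<phi> ` D"
    then obtain x where x: "x \<in> D" "A = \<phi> x" by blast
    have "\<phi> x = (\<lambda>s. (s, x s)) ` {s \<in> R. x s \<noteq> 0}" unfolding \<phi>_def by auto
    then show "A \<in> {A. finite A \<and> A \<subseteq> R \<times> UNIV}" using x unfolding D_def by auto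
  qed
  ultimately show ?thesis
    using R_countable countable_Collect_finite_subset[of "R \<times> (UNIV :: nat set)"]
    by (meson countable_SIGMA countable_image_inj_on countable_subset countableI_type)
qed

lemma second_countable_urysohn: "second_countable mtopology"
  unfolding second_countable_def
proof (intro exI conjI allI ballI impI)
  let ?\<B> = "(\<lambda>(q, r). mball q r) ` (D \<times> R)"
  show "countable ?\<B>" using countable_D R_countable by blast
  show "openin mtopology V" if "V \<in> ?\<B>" for V using that by auto
  fix U x assume "openin mtopology U \<and> x \<in> U"
  then obtain e where e: "e > 0" "mball x e \<subseteq> U" and x: "x \<in> X"
    unfolding openin_mtopology by blast
  obtain r where r: "r \<in> R" "r < e" using R_small[OF e(1)] by blast
  then have r0: "0 < r" using R_pos by auto
  \<comment> \<open>\<open>dist_trunc\<close> gives only a weak inequality; truncating at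
    \<open>r / 2\<close> makes the distance strictly less than \<open>r\<close>.\<close>
  define q where "q = trunc (r / 2) x"
  have q: "q \<in> D" "q \<in> X" "d x q < r"
    unfolding q_def using trunc_in_D[OF x] dist_trunc[OF x, of "r / 2"] trunc_closed[OF x] r0 by auto
  have "mball q r \<subseteq> mball x e"
    using q(2,3) x r(2) ultra_less[of x q _ r] by fastforce
  then show "\<exists>V\<in>?\<B>. x \<in> V \<and> V \<subseteq> U"
    using q r e(2) x commute[of x q] by (intro bexI[of _ "mball q r"]) auto
qed

text \<open>Coordinates of a Cauchy sequence become constant, uniformly over all coordinates from
  \<open>r\<close> on. So the limit agrees there with a single term, which also gives the finiteness
  condition.\<close>

lemma mcomplete_urysohn: mcomplete
  unfolding mcomplete_def
proof (intro allI impI)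
  fix \<sigma> assume \<sigma>: "MCauchy \<sigma>"
  then have \<sigma>X: "\<sigma> n \<in> X" for n unfolding MCauchy_def by auto
  have "\<exists>N. \<forall>n\<ge>N. d (\<sigma> n) (\<sigma> N) < r" if "0 < r" for r
    using \<sigma>[unfolded MCauchy_def, THEN conjunct2, rule_format, OF that] by blast
  then obtain N where N: "\<And>r n. 0 < r \<Longrightarrow> N r \<le> n \<Longrightarrow> d (\<sigma> n) (\<sigma> (N r)) < r" by metis
  define x where "x = (\<lambda>s\<in>R. \<sigma> (N s) s)"
  have x: "x s = \<sigma> n s" if s: "s \<in> R" "r \<le> s" "N r \<le> n" "0 < r" for r s n
  proof -
    have "\<sigma> m s = \<sigma> (N r) s" if "N r \<le> m" for m
      using N[OF s(4) that] s \<sigma>X by (simp add: dist_less_iff)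
    moreover have "\<sigma> m s = \<sigma> (N s) s" if "N s \<le> m" for m
      using N[OF _ that] s \<sigma>X by (simp add: dist_less_iff)
    ultimately have "\<sigma> (N s) s = \<sigma> n s" using s(3) by (metis max.cobounded1 max.cobounded2)
    then show ?thesis using s unfolding x_def by simp
  qed
  have xX: "x \<in> X"
  proof (rule urysohnI)
    fix r :: real assume r: "r > 0"
    have "{s \<in> R. s > r \<and> x s \<noteq> 0} = {s \<in> R. s > r \<and> \<sigma> (N r) s \<noteq> 0}"
      using x[of _ r "N r"] r by auto
    then show "finite {s \<in> R. s > r \<and> x s \<noteq> 0}" using urysohn_finite[OF \<sigma>X r] by simp
  qed (simp add: x_def)
  have "d (\<sigma> n) x < r" if "0 < r" "N r \<le> n" for r n
    using x[of _ r n] that \<sigma>X xX by (simp add: dist_less_iff)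
  then have "limitin mtopology \<sigma> x sequentially"
    unfolding limitin_metric eventually_sequentially using xX \<sigma>X by blast
  then show "\<exists>x. limitin mtopology \<sigma> x sequentially" by blast
qed

text \<open>
  Extends an isometric map on \<^const>\<open>D\<close> to all of \<^const>\<open>urysohn\<close>: the coordinate \<open>s\<close> of an image
  only depends on the coordinates from \<open>s\<close> on.
\<close>

definition ext :: "((real \<Rightarrow> nat) \<Rightarrow> real \<Rightarrow> nat) \<Rightarrow> (real \<Rightarrow> nat) \<Rightarrow> real \<Rightarrow> nat" where
  "ext a x = (\<lambda>s\<in>R. a (trunc (s / 2) x) s)"

definition isometric_on_D :: "((real \<Rightarrow> nat) \<Rightarrow> real \<Rightarrow> nat) \<Rightarrow> bool" where
  "isometric_on_D a \<longleftrightarrow> a \<in> D \<rightarrow> X \<and> (\<forall>p\<in>D. \<forall>q\<in>D. d (a p) (a q) = d p q)"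

lemma isometric_on_D_dest:
  assumes "isometric_on_D a"
  shows "q \<in> D \<Longrightarrow> a q \<in> X" "p \<in> D \<Longrightarrow> q \<in> D \<Longrightarrow> d (a p) (a q) = d p q"
  using assms unfolding isometric_on_D_def by auto

text \<open>Ultrametric perturbation: errors of at most \<open>t\<close> leave any distance above
  \<open>t\<close> unchanged.\<close>

lemma dist_approx:
  assumes "x \<in> X" "x' \<in> X" "y \<in> X" "y' \<in> X" "d x x' \<le> t" "d y y' \<le> t"
  shows "d x y = d x' y' \<or> (d x y \<le> t \<and> d x' y' \<le> t)"
  using assms ultra[of x x' y] ultra[of x' y' y] ultra[of x' x y'] ultra[of x y y']
    commute[of x' x] commute[of y' y] by linarith

text \<open>Every level \<open>t < s\<close> reads off the same coordinate \<open>s\<close>: the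
  truncations at \<open>t\<close> and at \<open>s / 2\<close> are less than \<open>s\<close> apart,
  hence so are their images. Thus the single point \<open>a (trunc t x)\<close> determines all
  coordinates of \<open>ext a x\<close> above \<open>t\<close>.\<close>

lemma ext_approx:
  assumes a: "isometric_on_D a"
    and x: "x \<in> X"
  shows "ext a x \<in> X" "0 < t \<Longrightarrow> d (ext a x) (a (trunc t x)) \<le> t"
proof -
  note a = isometric_on_D_dest[OF a]
  have eq: "ext a x s = a (trunc t x) s" if s: "s \<in> R" "t < s" "0 < t" for s t
  proof -
    have s2: "0 < s / 2" using s by simp
    have "d (trunc (s / 2) x) (trunc t x) < s"
      by (rule ultra_less[of _ x])
        (use s s2 x trunc_closed dist_trunc[OF x s2] dist_trunc[OF x s(3)] commute[of x "trunc (s / 2) x"] in auto)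
    then have "d (a (trunc (s / 2) x)) (a (trunc t x)) < s"
      using a(2) trunc_in_D[OF x s2] trunc_in_D[OF x s(3)] by simp
    then show ?thesis
      using s a(1) trunc_in_D[OF x s2] trunc_in_D[OF x s(3)] unfolding ext_def
      by (simp add: dist_less_iff)
  qed
  show X: "ext a x \<in> X"
  proof (rule urysohnI)
    fix r :: real assume r: "r > 0"
    have "{s \<in> R. s > r \<and> ext a x s \<noteq> 0} = {s \<in> R. s > r \<and> a (trunc r x) s \<noteq> 0}"
      using eq r by auto
    then show "finite {s \<in> R. s > r \<and> ext a x s \<noteq> 0}"
      using urysohn_finite[OF a(1)[OF trunc_in_D[OF x r]] r] by simp
  qed (simp add: ext_def)
  show "d (ext a x) (a (trunc t x)) \<le> t" if "0 < t"
    using X a(1)[OF trunc_in_D[OF x that]] eq that by (simp add: dist_le_iff)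
qed

lemma eq_if_dist_small:
  assumes "x \<in> X" "y \<in> X" "\<And>t. 0 < t \<Longrightarrow> d x y \<le> t"
  shows "x = y"
  using assms(3)[of "d x y / 2"] assms(1,2) nonneg[of x y] by (cases "d x y = 0") auto

text \<open>Adjointness expresses that \<open>b\<close> inverts \<open>a\<close> without composing
  the two, which would fail on \<open>D\<close> since \<open>b q\<close> may lie outside
  \<open>D\<close>.\<close>

lemma ext_adjoint:
  assumes a: "isometric_on_D a"
    and b: "isometric_on_D b"
    and ab: "\<And>p q. p \<in> D \<Longrightarrow> q \<in> D \<Longrightarrow> d (a p) q = d p (b q)"
    and x: "x \<in> X" and y: "y \<in> X"
  shows "d (ext a x) y = d x (ext b y)"
proof (rule ccontr)
  assume ne: "d (ext a x) y \<noteq> d x (ext b y)"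
  \<comment> \<open>Half of the larger distance: that one exceeds \<open>t\<close>, so truncation
    leaves it unchanged, and adjointness on \<open>D\<close> forces the other to equal it.\<close>
  define t where "t = max (d (ext a x) y) (d x (ext b y)) / 2"
  have t: "0 < t" using ne nonneg[of "ext a x" y] nonneg[of x "ext b y"] unfolding t_def by linarith
  note T = isometric_on_D_dest[OF a] isometric_on_D_dest[OF b] trunc_in_D[OF x t] trunc_in_D[OF y t]
  have "d (ext a x) y = d (a (trunc t x)) (trunc t y) \<or>
      (d (ext a x) y \<le> t \<and> d (a (trunc t x)) (trunc t y) \<le> t)"
    using ext_approx[OF a x] t T y dist_trunc[OF y t] trunc_closed[OF y t] by (intro dist_approx) auto
  moreover have "d x (ext b y) = d (trunc t x) (b (trunc t y)) \<or>
      (d x (ext b y) \<le> t \<and> d (trunc t x) (b (trunc t y)) \<le> t)"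
    using ext_approx[OF b y] t T x dist_trunc[OF x t] trunc_closed[OF x t] by (intro dist_approx) auto
  ultimately show False
    using ab[OF trunc_in_D[OF x t] trunc_in_D[OF y t]] ne t unfolding t_def by linarith
qed

lemma ext_D:
  assumes a: "isometric_on_D a"
    and q: "q \<in> D"
  shows "ext a q = a q"
proof (rule eq_if_dist_small)
  have qX: "q \<in> X" using q D_subset by blast
  note e = ext_approx[OF a qX]
  note a = isometric_on_D_dest[OF a]
  show "ext a q \<in> X" by (rule e(1))
  show "a q \<in> X" by (rule a(1)[OF q])
  fix t :: real assume t: "0 < t"
  have tq: "trunc t q \<in> D" by (rule trunc_in_D[OF qX t])
  have "d (a (trunc t q)) (a q) \<le> t"
    using a(2)[OF tq q] dist_trunc[OF qX t] commute[of q "trunc t q"] by simp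
  then show "d (ext a q) (a q) \<le> t"
    by (rule ultra_le[OF e(1) a(1)[OF tq] a(1)[OF q] e(2)[OF t]])
qed

lemma ext_iso:
  assumes g: "g \<in> carrier G" and x: "x \<in> X"
  shows "ext (restrict g D) x = g x"
proof (rule eq_if_dist_small)
  have a: "isometric_on_D (restrict g D)"
    using g D_subset iso_closed iso_dist unfolding isometric_on_D_def by (auto simp: subset_iff)
  note e = ext_approx[OF a x]
  show "ext (restrict g D) x \<in> X" by (rule e(1))
  show "g x \<in> X" by (rule iso_closed[OF g x])
  fix t :: real assume t: "0 < t"
  have "d (g (trunc t x)) (g x) \<le> t"
    using iso_dist[OF g trunc_closed[OF x t] x] dist_trunc[OF x t] commute[of x "trunc t x"] by simp
  moreover have "d (ext (restrict g D) x) (g (trunc t x)) \<le> t"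
    using e(2)[OF t] trunc_in_D[OF x t] by simp
  ultimately show "d (ext (restrict g D) x) (g x) \<le> t"
    by (rule ultra_le[OF e(1) iso_closed[OF g trunc_closed[OF x t]] iso_closed[OF g x], rotated])
qed

section \<open>Isometries as a closed set of graphs over the dense set\<close>

abbreviation P :: "((real \<Rightarrow> nat) + (real \<Rightarrow> nat) \<Rightarrow> real \<Rightarrow> nat) topology" where
  "P \<equiv> product_topology (\<lambda>_. mtopology) (D <+> D)"

text \<open>The inverse is recorded as well, so that a limit of graphs still describes a surjective
  map.\<close>

definition graph :: "((real \<Rightarrow> nat) \<Rightarrow> real \<Rightarrow> nat) \<Rightarrow> (real \<Rightarrow> nat) + (real \<Rightarrow> nat) \<Rightarrow> real \<Rightarrow> nat" where
  "graph g = (\<lambda>u\<in>D <+> D. case_sum g (inv\<^bsub>G\<^esub> g) u)"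

text \<open>Every condition equates continuous functions of finitely many coordinates, so the set is
  closed. The adjoint condition says that the two halves are inverse to each other.\<close>

definition graphs :: "((real \<Rightarrow> nat) + (real \<Rightarrow> nat) \<Rightarrow> real \<Rightarrow> nat) set" where
  "graphs = {c \<in> topspace P. \<forall>p\<in>D. \<forall>q\<in>D. d (c (Inl p)) (c (Inl q)) = d p q \<and>
     d (c (Inr p)) (c (Inr q)) = d p q \<and> d (c (Inl p)) q = d p (c (Inr q))}"

lemma closedin_graphs: "closedin P graphs"
proof -
  have proj: "continuous_map P mtopology (\<lambda>c. c u)" if "u \<in> D <+> D" for u
    by (rule continuous_map_product_projection[OF that])
  have const: "continuous_map P mtopology (\<lambda>c. q)" if "q \<in> D" for q
    using that D_subset by auto
  have closed: "closedin P {c \<in> topspace P. d (f c) (f' c) = d (g c) (g' c)}"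
    if "continuous_map P mtopology f" "continuous_map P mtopology f'"
      "continuous_map P mtopology g" "continuous_map P mtopology g'" for f f' g g'
  proof (rule closedin_continuous_maps_eq)
    show "continuous_map P euclideanreal (\<lambda>c. d (f c) (f' c))" "continuous_map P euclideanreal (\<lambda>c. d (g c) (g' c))"
      using that continuous_map_mdist[of P "metric (X, d)" f f'] continuous_map_mdist[of P "metric (X, d)" g g']
      by simp_all
  qed simp
  define C where "C p q = {c \<in> topspace P. d (c (Inl p)) (c (Inl q)) = d p q} \<inter>
    ({c \<in> topspace P. d (c (Inr p)) (c (Inr q)) = d p q} \<inter>
     {c \<in> topspace P. d (c (Inl p)) q = d p (c (Inr q))})" for p q
  have "closedin P (C p q)" if "p \<in> D" "q \<in> D" for p q
    unfolding C_def using that by (intro closedin_Int closed proj const) auto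
  moreover have "D \<noteq> {}" using trunc_in_D[OF zero_in_urysohn, of 1] by auto
  ultimately have "closedin P (\<Inter>p\<in>D. \<Inter>q\<in>D. C p q)"
    by (intro closedin_INT) auto
  moreover have "graphs = (\<Inter>p\<in>D. \<Inter>q\<in>D. C p q)"
    unfolding graphs_def C_def using \<open>D \<noteq> {}\<close> by auto
  ultimately show ?thesis by simp
qed

lemma topspace_P: "topspace P = (D <+> D) \<rightarrow>\<^sub>E X"
  by simp

definition iso_of_graph :: "((real \<Rightarrow> nat) + (real \<Rightarrow> nat) \<Rightarrow> real \<Rightarrow> nat) \<Rightarrow> (real \<Rightarrow> nat) \<Rightarrow> real \<Rightarrow> nat" where
  "iso_of_graph c = restrict (ext (c \<circ> Inl)) X"

lemma graph_in_graphs: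
  assumes g: "g \<in> carrier G"
  shows "graph g \<in> graphs"
proof -
  have gX: "g q \<in> X" "(inv\<^bsub>G\<^esub> g) q \<in> X" if "q \<in> D" for q
    using that D_subset iso_closed g by auto
  have "d (g p) q = d p ((inv\<^bsub>G\<^esub> g) q)" if "p \<in> D" "q \<in> D" for p q
    using iso_dist[OF g, of p "(inv\<^bsub>G\<^esub> g) q"] that D_subset gX g by (auto simp: subset_iff)
  then show ?thesis
    using gX iso_dist[OF g] iso_dist[OF G.inv_closed[OF g]] D_subset
    unfolding graphs_def topspace_P graph_def by (auto simp: subset_iff split: sum.splits)
qed

lemma graphsD:
  assumes c: "c \<in> graphs"
  shows "isometric_on_D (c \<circ> Inl)" "isometric_on_D (c \<circ> Inr)"
    "\<And>p q. p \<in> D \<Longrightarrow> q \<in> D \<Longrightarrow> d ((c \<circ> Inl) p) q = d p ((c \<circ> Inr) q)"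
  using c unfolding graphs_def topspace_P isometric_on_D_def by (auto simp: PiE_def Pi_def)

lemma iso_of_graph:
  assumes c: "c \<in> graphs"
  shows "iso_of_graph c \<in> carrier G" "graph (iso_of_graph c) = c"
proof -
  note a = graphsD(1)[OF c] and b = graphsD(2)[OF c]
  have adj: "d (ext (c \<circ> Inl) x) y = d x (ext (c \<circ> Inr) y)" if "x \<in> X" "y \<in> X" for x y
    by (rule ext_adjoint[OF a b graphsD(3)[OF c] that])
  \<comment> \<open>Adjointness turns the distance between \<open>y\<close> and its image under both
    extensions into the distance of a point from itself.\<close>
  have inv: "ext (c \<circ> Inl) (ext (c \<circ> Inr) y) = y" "ext (c \<circ> Inr) (ext (c \<circ> Inl) y) = y" if "y \<in> X" for y
    using adj[of "ext (c \<circ> Inr) y" y] adj[of y "ext (c \<circ> Inl) y"] ext_approx(1)[OF a] ext_approx(1)[OF b] that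
    by auto
  show G: "iso_of_graph c \<in> carrier G"
    unfolding iso_of_graph_def
  proof (rule isoI)
    show "ext (c \<circ> Inl) x \<in> X" if "x \<in> X" for x by (rule ext_approx(1)[OF a that])
    show "d (ext (c \<circ> Inl) x) (ext (c \<circ> Inl) y) = d x y" if "x \<in> X" "y \<in> X" for x y
      using adj[OF that(1) ext_approx(1)[OF a that(2)]] inv(2)[OF that(2)] by simp
    show "\<exists>x\<in>X. ext (c \<circ> Inl) x = y" if "y \<in> X" for y
      using inv(1)[OF that] ext_approx(1)[OF b that] by blast
  qed
  have "(inv\<^bsub>G\<^esub> iso_of_graph c) y = ext (c \<circ> Inr) y" if y: "y \<in> X" for y
  proof -
    have e: "ext (c \<circ> Inr) y \<in> X" by (rule ext_approx(1)[OF b y])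
    have "iso_of_graph c (ext (c \<circ> Inr) y) = y" unfolding iso_of_graph_def using e inv(1)[OF y] by simp
    then show ?thesis using iso_inv_apply(1)[OF G e] by simp
  qed
  then have "graph (iso_of_graph c) u = c u" if "u \<in> D <+> D" for u
    using that ext_D[OF a] ext_D[OF b] D_subset unfolding graph_def iso_of_graph_def by auto
  then show "graph (iso_of_graph c) = c"
    using c unfolding graphs_def topspace_P
    by (intro extensionalityI[of _ "D <+> D"]) (auto simp: graph_def PiE_def)
qed

lemma iso_of_graph_graph:
  assumes g: "g \<in> carrier G"
  shows "iso_of_graph (graph g) = g"
proof (rule iso_eqI[OF iso_of_graph(1)[OF graph_in_graphs[OF g]] g])
  fix x assume x: "x \<in> X"
  have t: "trunc (s / 2) x \<in> D" if "s \<in> R" for s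
    using trunc_in_D[OF x] R_pos that by auto
  have "ext (graph g \<circ> Inl) x = ext (restrict g D) x"
    unfolding ext_def graph_def using t by (intro restrict_ext) (simp add: InlI)
  then show "iso_of_graph (graph g) x = g x"
    using ext_iso[OF g x] x unfolding iso_of_graph_def by simp
qed

lemma continuous_graph: "continuous_map T (subtopology P graphs) graph"
proof -
  have "continuous_map T mtopology (\<lambda>g. (inv\<^bsub>G\<^esub> g) q)" if "q \<in> X" for q
  proof -
    have "continuous_map T mtopology ((\<lambda>g. g q) \<circ> (\<lambda>g. inv\<^bsub>G\<^esub> g))"
      using topological_group_Iso continuous_eval[OF that] unfolding topological_group_def
      by (blast intro: continuous_map_compose)
    then show ?thesis by (simp add: o_def)
  qed
  then have "continuous_map T mtopology (\<lambda>g. graph g u)" if "u \<in> D <+> D" for u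
    using that D_subset continuous_eval unfolding graph_def by (auto simp: subset_iff)
  then show ?thesis
    using graph_in_graphs unfolding continuous_map_in_subtopology continuous_map_componentwise
    by (auto simp: topspace_Iso graph_def)
qed

lemma continuous_iso_of_graph: "continuous_map (subtopology P graphs) T iso_of_graph"
proof (rule continuous_map_into_Iso)
  have top: "topspace (subtopology P graphs) = graphs"
    unfolding topspace_subtopology graphs_def by auto
  show "iso_of_graph \<in> topspace (subtopology P graphs) \<rightarrow> carrier G"
    using iso_of_graph(1) unfolding top by auto
  fix x assume x: "x \<in> X"
  show "continuous_map (subtopology P graphs) mtopology (\<lambda>c. iso_of_graph c x)"
    unfolding continuous_map_to_metric top
  proof (intro ballI allI impI)
    fix c and e :: real assume c: "c \<in> graphs" and e: "e > 0"
    \<comment> \<open>\<open>q\<close> is chosen independently of the graph: coordinate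
      \<open>Inl q\<close> approximates evaluation at \<open>x\<close> within \<open>e\<close> for
      all graphs at once.\<close>
    define q where "q = trunc (e / 2) x"
    have q: "q \<in> D" "Inl q \<in> D <+> D" unfolding q_def using trunc_in_D[OF x] e by auto
    have near: "iso_of_graph c x \<in> X" "d (iso_of_graph c x) (c (Inl q)) < e" "c (Inl q) \<in> X"
      if "c \<in> graphs" for c
      using ext_approx(1)[OF graphsD(1)[OF that] x] ext_approx(2)[OF graphsD(1)[OF that] x, of "e / 2"]
        isometric_on_D_dest(1)[OF graphsD(1)[OF that] q(1)]
        x e unfolding iso_of_graph_def q_def by auto
    define U where "U = {c' \<in> topspace P. c' (Inl q) \<in> mball (c (Inl q)) e} \<inter> graphs"
    have "openin (subtopology P graphs) U"
      unfolding U_def using continuous_map_product_projection[OF q(2)]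
      by (intro openin_subtopology_Int openin_continuous_map_preimage[of _ mtopology]) auto
    moreover have "c \<in> U" using c near[OF c] e unfolding U_def graphs_def by auto
    moreover have "iso_of_graph c' x \<in> mball (iso_of_graph c x) e" if "c' \<in> U" for c'
    proof -
      have c': "c' \<in> graphs" "d (c (Inl q)) (c' (Inl q)) < e" using that unfolding U_def by auto
      have "d (iso_of_graph c x) (c' (Inl q)) < e"
        by (rule ultra_less[OF near(1)[OF c] near(3)[OF c] near(3)[OF c'(1)] near(2)[OF c] c'(2)])
      moreover have "d (c' (Inl q)) (iso_of_graph c' x) < e" using near(2)[OF c'(1)] by (simp add: commute)
      ultimately have "d (iso_of_graph c x) (iso_of_graph c' x) < e"
        by (rule ultra_less[OF near(1)[OF c] near(3)[OF c'(1)] near(1)[OF c'(1)]])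
      then show ?thesis using near(1) c c'(1) by simp
    qed
    ultimately show "\<exists>U. openin (subtopology P graphs) U \<and> c \<in> U \<and>
        (\<forall>c'\<in>U. iso_of_graph c' x \<in> mball (iso_of_graph c x) e)" by blast
  qed
qed

lemma Iso_homeomorphic_graphs: "T homeomorphic_space subtopology P graphs"
  unfolding homeomorphic_space_def homeomorphic_maps_def
  using continuous_graph continuous_iso_of_graph iso_of_graph_graph iso_of_graph(2)
  by (intro exI[of _ graph] exI[of _ iso_of_graph]) (auto simp: topspace_Iso graphs_def)

lemma completely_metrizable_Iso: "completely_metrizable_space T"
proof -
  have "countable (D <+> D)" using countable_D by simp
  then have "completely_metrizable_space P"
    using completely_metrizable_space_mtopology[OF mcomplete_urysohn]
    by (auto simp: completely_metrizable_space_product_topology intro: countable_subset)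
  then show ?thesis
    using homeomorphic_completely_metrizable_space[OF Iso_homeomorphic_graphs]
      completely_metrizable_space_closedin closedin_graphs by blast
qed

lemma second_countable_Iso: "second_countable T"
proof -
  have "second_countable P"
    using countable_D second_countable_urysohn by (intro second_countable_product_topology) auto
  then show ?thesis
    using homeomorphic_space_second_countability[OF Iso_homeomorphic_graphs] second_countable_subtopology
    by blast
qed

lemma polish_group_Iso: "polish_group G T"
  unfolding polish_group_def
  using topological_group_Iso completely_metrizable_Iso
    second_countable_imp_separable_space[OF second_countable_Iso] by blast

section \<open>Countable cofinality and ample generics\<close>

lemma countable_cofinality_Iso: "countable_cofinality G"
proof -
  \<comment> \<open>Radii in \<open>R\<close> are distances that occur, which makes the chain
    strict; \<open>real k \<le> f k\<close> makes it exhaust the group.\<close>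
  have "\<exists>f. \<forall>k. (f k \<in> R \<and> real k \<le> f k) \<and> f k < f (Suc k)"
  proof (rule dependent_nat_choice)
    show "\<exists>x. x \<in> R \<and> real 0 \<le> x" using R_unbounded[of 0] by auto
    show "\<exists>y. (y \<in> R \<and> real (Suc n) \<le> y) \<and> x < y" for x n
      using R_unbounded[of "max (x + 1) (real (Suc n))"] by force
  qed
  then obtain r where r: "\<And>k. r k \<in> R" "\<And>k. real k \<le> r k" "\<And>k. r k < r (Suc k)" by blast
  define o' where "o' = (\<lambda>s\<in>R. 0 :: nat)"
  have o': "o' \<in> X" unfolding o'_def by (rule zero_in_urysohn)
  define H where "H k = {g \<in> carrier G. d (g o') o' \<le> r k}" for k
  have r0: "0 < r k" for k using r(1)[of k] R_pos by auto
  have "subgroup (H k) G" for k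
  proof (rule G.subgroupI)
    show "H k \<subseteq> carrier G" unfolding H_def by auto
    have "\<one>\<^bsub>G\<^esub> \<in> H k" unfolding H_def using o' r0[of k] by simp
    then show "H k \<noteq> {}" by blast
  next
    fix g assume "g \<in> H k"
    then have g: "g \<in> carrier G" "d (g o') o' \<le> r k" unfolding H_def by auto
    have "d (g ((inv\<^bsub>G\<^esub> g) o')) (g o') = d ((inv\<^bsub>G\<^esub> g) o') o'"
      by (rule iso_dist) (use g(1) o' iso_closed in auto)
    then show "inv\<^bsub>G\<^esub> g \<in> H k" unfolding H_def using g o' commute[of o' "g o'"] by simp
  next
    fix g h assume "g \<in> H k" "h \<in> H k"
    then have g: "g \<in> carrier G" "d (g o') o' \<le> r k" and h: "h \<in> carrier G" "d (h o') o' \<le> r k"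
      unfolding H_def by auto
    have "d (g (h o')) o' \<le> r k"
      by (rule ultra_le[of _ "g o'"])
        (use g h o' iso_closed iso_dist[OF g(1) iso_closed[OF h(1) o'] o'] in auto)
    then show "g \<otimes>\<^bsub>G\<^esub> h \<in> H k" unfolding H_def using g h o' by simp
  qed
  moreover have "H k \<subset> H (Suc k)" for k
  proof
    show "H k \<subseteq> H (Suc k)" unfolding H_def using r(3)[of k] by auto
    \<comment> \<open>Swapping \<open>o'\<close> with a point at distance exactly
      \<open>r (Suc k)\<close> gives an isometry that is new at stage \<open>Suc k\<close>.\<close>
    define y where "y = o'(r (Suc k) := 1)"
    have "y \<in> X"
    proof (rule urysohnI)
      show "y \<in> extensional R" using r(1) unfolding y_def o'_def by (auto simp: extensional_def)
      show "finite {s \<in> R. s > t \<and> y s \<noteq> 0}" for t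
        by (rule finite_subset[of _ "{r (Suc k)}"]) (auto simp: y_def o'_def)
    qed
    moreover have "d y o' = r (Suc k)"
      by (rule dist_eqI[OF \<open>y \<in> X\<close> o' r(1)]) (use r(1) in \<open>auto simp: y_def o'_def\<close>)
    ultimately have "ball_swap o' y \<in> H (Suc k)" "ball_swap o' y \<notin> H k"
      using ball_swap(1,2)[OF o'] r(3)[of k] unfolding H_def by auto
    then show "H k \<noteq> H (Suc k)" by blast
  qed
  then have "strict_mono H" by (simp add: strict_mono_Suc_iff)
  moreover have "(\<Union>k. H k) = carrier G"
  proof
    show "carrier G \<subseteq> (\<Union>k. H k)"
    proof
      fix g assume g: "g \<in> carrier G"
      obtain k where "d (g o') o' \<le> real k" using real_arch_simple by blast
      then have "g \<in> H k" using g r(2)[of k] unfolding H_def by simp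
      then show "g \<in> (\<Union>k. H k)" by blast
    qed
  qed (auto simp: H_def)
  ultimately show ?thesis unfolding countable_cofinality_def by blast
qed

section \<open>The diagonal conjugation action\<close>

abbreviation Z :: "nat \<Rightarrow> (nat \<Rightarrow> (real \<Rightarrow> nat) \<Rightarrow> real \<Rightarrow> nat) topology" where
  "Z n \<equiv> product_topology (\<lambda>_. T) {..n}"

definition conj_act :: "nat \<Rightarrow> ((real \<Rightarrow> nat) \<Rightarrow> real \<Rightarrow> nat) \<Rightarrow> (nat \<Rightarrow> (real \<Rightarrow> nat) \<Rightarrow> real \<Rightarrow> nat) \<Rightarrow>
    nat \<Rightarrow> (real \<Rightarrow> nat) \<Rightarrow> real \<Rightarrow> nat" where
  "conj_act n g x = (\<lambda>i\<in>{..n}. g \<otimes>\<^bsub>G\<^esub> x i \<otimes>\<^bsub>G\<^esub> inv\<^bsub>G\<^esub> g)"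

lemma topspace_Z: "topspace (Z n) = {..n} \<rightarrow>\<^sub>E carrier G"
  by (simp add: topspace_Iso)

lemma Z_neighbourhood:
  assumes W: "openin (Z n) W" and g: "g \<in> W"
  shows "\<exists>A t. finite A \<and> A \<subseteq> X \<and> 0 < t \<and>
    (\<forall>h\<in>topspace (Z n). (\<forall>i\<le>n. \<forall>a\<in>A. d (h i a) (g i a) < t) \<longrightarrow> h \<in> W)"
proof -
  obtain U where U: "\<forall>i\<in>{..n}. openin T (U i)" "g \<in> Pi\<^sub>E {..n} U" "Pi\<^sub>E {..n} U \<subseteq> W"
    using W g unfolding openin_product_topology_alt by auto
  have "\<exists>A t. finite A \<and> A \<subseteq> X \<and> 0 < t \<and> (\<forall>h\<in>carrier G. (\<forall>a\<in>A. d (h a) (g i a) < t) \<longrightarrow> h \<in> U i)"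
    if i: "i \<in> {..n}" for i
  proof (rule Iso_neighbourhood)
    show "openin T (U i)" "g i \<in> U i" using U(1,2) i by auto
  qed
  then obtain A t where At: "\<And>i. i \<in> {..n} \<Longrightarrow> finite (A i) \<and> A i \<subseteq> X \<and> 0 < t i \<and>
      (\<forall>h\<in>carrier G. (\<forall>a\<in>A i. d (h a) (g i a) < t i) \<longrightarrow> h \<in> U i)"
    by metis
  define t' where "t' = Min (t ` {..n})"
  have t': "t' \<le> t i" if "i \<in> {..n}" for i unfolding t'_def using that by (intro Min_le) auto
  have "0 < t'" unfolding t'_def using At by (subst Min_gr_iff) auto
  moreover have "h \<in> W"
    if h: "h \<in> topspace (Z n)" "\<forall>i\<le>n. \<forall>a\<in>(\<Union>i\<le>n. A i). d (h i a) (g i a) < t'" for h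
  proof -
    have "h i \<in> U i" if i: "i \<in> {..n}" for i
    proof -
      have "h i \<in> carrier G" using h(1) i unfolding topspace_Z by auto
      moreover have "d (h i a) (g i a) < t i" if "a \<in> A i" for a
        using h(2) i that t'[OF i] by (force intro: less_le_trans)
      ultimately show ?thesis using At[OF i] by blast
    qed
    then have "h \<in> Pi\<^sub>E {..n} U" using h(1) unfolding topspace_Z by (auto simp: PiE_def)
    then show ?thesis using U(3) by blast
  qed
  moreover have "finite (\<Union>i\<le>n. A i)" "(\<Union>i\<le>n. A i) \<subseteq> X" using At by auto
  ultimately show ?thesis by blast
qed

text \<open>Amalgamation over the test points of neighbourhoods inside \<open>W1\<close> and
  \<open>W2\<close>: the amalgamated tuple equals \<open>h1\<close> on the former, and its conjugate
  by the inverse of \<open>w\<close> equals \<open>h2\<close> on the latter. \<open>e\<close> ranges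
  over all of \<open>R\<close>, since it is taken small for the local condition and large for
  transitivity.\<close>

lemma conj_connects:
  assumes W: "openin (Z n) W1" "h1 \<in> W1" "openin (Z n) W2" "h2 \<in> W2"
    and B: "finite B" "B \<noteq> {}" "B \<subseteq> X" and e: "e \<in> R"
    and p: "\<And>i. i \<le> n \<Longrightarrow> p i ` B = B"
    and near: "\<And>i b. i \<le> n \<Longrightarrow> b \<in> B \<Longrightarrow> d (h1 i b) (p i b) \<le> e" "\<And>i b. i \<le> n \<Longrightarrow> b \<in> B \<Longrightarrow> d (h2 i b) (p i b) \<le> e"
  shows "\<exists>w\<in>carrier G. (\<forall>b\<in>B. d (w b) b \<le> e) \<and> (\<exists>z\<in>W1. conj_act n (inv\<^bsub>G\<^esub> w) z \<in> W2)"
proof -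
  have h: "h1 \<in> topspace (Z n)" "h2 \<in> topspace (Z n)" using W openin_subset by blast+
  then have hG: "h1 i \<in> carrier G" "h2 i \<in> carrier G" if "i \<le> n" for i using that unfolding topspace_Z by auto
  obtain A1 t1 where 1: "finite A1" "A1 \<subseteq> X" "0 < t1"
    "\<And>h. h \<in> topspace (Z n) \<Longrightarrow> (\<forall>i\<le>n. \<forall>a\<in>A1. d (h i a) (h1 i a) < t1) \<Longrightarrow> h \<in> W1"
    using Z_neighbourhood[OF W(1,2)] by blast
  obtain A2 t2 where 2: "finite A2" "A2 \<subseteq> X" "0 < t2"
    "\<And>h. h \<in> topspace (Z n) \<Longrightarrow> (\<forall>i\<le>n. \<forall>a\<in>A2. d (h i a) (h2 i a) < t2) \<Longrightarrow> h \<in> W2"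
    using Z_neighbourhood[OF W(3,4)] by blast
  have "\<exists>w\<in>carrier G. \<exists>h. (\<forall>b\<in>B. d (w b) b \<le> e) \<and>
    (\<forall>i\<in>{..n}. h i \<in> carrier G \<and> (\<forall>c\<in>A1 \<union> A2. h i c = h1 i c \<and> h i (w c) = w (h2 i c)))"
    using 1(1,2) 2(1,2) B e p near hG by (intro amalgamation[where p = p]) auto
  then obtain w h where w: "w \<in> carrier G" "\<forall>b\<in>B. d (w b) b \<le> e"
    and h': "\<forall>i\<in>{..n}. h i \<in> carrier G \<and> (\<forall>c\<in>A1 \<union> A2. h i c = h1 i c \<and> h i (w c) = w (h2 i c))"
    by (elim bexE exE conjE) (rule that)
  have h: "h i \<in> carrier G" "c \<in> A1 \<union> A2 \<Longrightarrow> h i c = h1 i c"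
    "c \<in> A1 \<union> A2 \<Longrightarrow> h i (w c) = w (h2 i c)" if "i \<le> n" for i c
    using h' that by auto
  define z where "z = restrict h {..n}"
  have "z \<in> topspace (Z n)" unfolding z_def topspace_Z using h(1) by auto
  moreover have "d (z i a) (h1 i a) < t1" if "i \<le> n" "a \<in> A1" for i a
    using that h(2)[of i a] 1(2,3) iso_closed[OF hG(1)[of i]] unfolding z_def by auto
  ultimately have "z \<in> W1" using 1(4) by blast
  moreover have "conj_act n (inv\<^bsub>G\<^esub> w) z \<in> W2"
  proof (rule 2(4))
    show "conj_act n (inv\<^bsub>G\<^esub> w) z \<in> topspace (Z n)"
      unfolding conj_act_def topspace_Z z_def using h(1) w(1) by auto
    show "\<forall>i\<le>n. \<forall>a\<in>A2. d (conj_act n (inv\<^bsub>G\<^esub> w) z i a) (h2 i a) < t2"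
    proof (intro allI impI ballI)
      fix i a assume i: "i \<le> n" and a: "a \<in> A2"
      have X: "a \<in> X" "w a \<in> X" "h2 i a \<in> X" using a 2(2) iso_closed w(1) hG(2)[OF i] by auto
      have "conj_act n (inv\<^bsub>G\<^esub> w) z i a = (inv\<^bsub>G\<^esub> w) (h i (w a))"
        unfolding conj_act_def z_def using i w(1) h(1)[OF i] X by simp
      also have "\<dots> = h2 i a" using h(3)[OF i, of a] a w(1) X by simp
      finally show "d (conj_act n (inv\<^bsub>G\<^esub> w) z i a) (h2 i a) < t2" using X 2(3) by simp
    qed
  qed
  ultimately show ?thesis using w by blast
qed

text \<open>A large \<open>e\<close> makes any two tuples agree up to \<open>e\<close> on a single point, so no new amalgam is needed.\<close>

lemma conj_transitive:
  assumes W: "openin (Z n) W1" "W1 \<noteq> {}" "openin (Z n) W2" "W2 \<noteq> {}"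
  shows "\<exists>g\<in>carrier G. \<exists>z\<in>W1. conj_act n g z \<in> W2"
proof -
  obtain h1 h2 where h: "h1 \<in> W1" "h2 \<in> W2" using W by auto
  define o' where "o' = (\<lambda>s\<in>R. 0 :: nat)"
  have o': "o' \<in> X" unfolding o'_def by (rule zero_in_urysohn)
  define M where "M = Max ((\<lambda>i. max (d (h1 i o') o') (d (h2 i o') o')) ` {..n})"
  obtain e where e: "e \<in> R" "M \<le> e" using R_unbounded by blast
  have "max (d (h1 i o') o') (d (h2 i o') o') \<le> e" if "i \<le> n" for i
  proof -
    have "max (d (h1 i o') o') (d (h2 i o') o') \<le> M"
      unfolding M_def by (rule Max_ge) (use that in auto)
    then show ?thesis using e(2) by (rule order_trans)
  qed
  then have "\<exists>w\<in>carrier G. (\<forall>b\<in>{o'}. d (w b) b \<le> e) \<and> (\<exists>z\<in>W1. conj_act n (inv\<^bsub>G\<^esub> w) z \<in> W2)"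
    using W h o' e(1) by (intro conj_connects[where p = "\<lambda>_ x. x"]) auto
  then show ?thesis by blast
qed

text \<open>One finite set \<open>B\<close> serves two purposes: tuples close to \<open>p\<close> on
  \<open>B\<close> stay in \<open>U\<close>, tested on \<open>A1\<close>, and an element that barely
  moves \<open>B\<close> lies in \<open>V\<close>, tested on \<open>A2\<close>. Both test sets lie
  within \<open>e\<close> of \<open>B\<close>.\<close>

lemma conj_local:
  assumes V: "openin T V" "\<one>\<^bsub>G\<^esub> \<in> V" and U: "openin (Z n) U" "U \<noteq> {}"
  shows "\<exists>U'. openin (Z n) U' \<and> U' \<noteq> {} \<and> U' \<subseteq> U \<and>
    (\<forall>W1 W2. openin (Z n) W1 \<longrightarrow> W1 \<noteq> {} \<longrightarrow> W1 \<subseteq> U' \<longrightarrow>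
      openin (Z n) W2 \<longrightarrow> W2 \<noteq> {} \<longrightarrow> W2 \<subseteq> U' \<longrightarrow> (\<exists>v\<in>V. \<exists>z\<in>W1. conj_act n v z \<in> W2))"
proof -
  obtain g where g: "g \<in> U" using U by auto
  then have gG: "g i \<in> carrier G" if "i \<le> n" for i
    using that openin_subset[OF U(1)] unfolding topspace_Z by auto
  obtain A1 t1 where 1: "finite A1" "A1 \<subseteq> X" "0 < t1"
    "\<And>h. h \<in> topspace (Z n) \<Longrightarrow> (\<forall>i\<le>n. \<forall>a\<in>A1. d (h i a) (g i a) < t1) \<Longrightarrow> h \<in> U"
    using Z_neighbourhood[OF U(1) g] by blast
  obtain A2 t2 where 2: "finite A2" "A2 \<subseteq> X" "0 < t2"
    "\<And>v. v \<in> carrier G \<Longrightarrow> (\<forall>a\<in>A2. d (v a) (\<one>\<^bsub>G\<^esub> a) < t2) \<Longrightarrow> v \<in> V"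
    using Iso_neighbourhood[OF V] by blast
  obtain e where e: "e \<in> R" "e < min t1 t2" using R_small[of "min t1 t2"] 1(3) 2(3) by auto
  have e0: "0 < e" using e(1) R_pos by auto
  have "\<exists>B p. finite B \<and> B \<noteq> {} \<and> B \<subseteq> X \<and>
    (\<forall>i\<in>{..n}. p i \<in> carrier G \<and> p i ` B = B \<and> (\<forall>a\<in>A1 \<union> A2. d (p i a) (g i a) \<le> e)) \<and>
    (\<forall>a\<in>A1 \<union> A2. \<exists>b\<in>B. d a b \<le> e)"
    using 1(1,2) 2(1,2) e0 gG by (intro finite_approximation) auto
  then obtain B p where B: "finite B" "B \<noteq> {}" "B \<subseteq> X"
    and p': "\<forall>i\<in>{..n}. p i \<in> carrier G \<and> p i ` B = B \<and> (\<forall>a\<in>A1 \<union> A2. d (p i a) (g i a) \<le> e)"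
    and near: "\<forall>a\<in>A1 \<union> A2. \<exists>b\<in>B. d a b \<le> e"
    by (elim exE conjE) (rule that)
  have p: "p i \<in> carrier G" "p i ` B = B" "a \<in> A1 \<union> A2 \<Longrightarrow> d (p i a) (g i a) \<le> e" if "i \<le> n" for i a
    using p' that by auto
  \<comment> \<open>The strict inequality makes \<open>U'\<close> open; amalgamation uses the weak
    one.\<close>
  define U' where "U' = {h \<in> topspace (Z n). \<forall>i\<le>n. \<forall>b\<in>B. d (h i b) (p i b) < e}"
  have "openin (Z n) U'"
  proof -
    have "openin (Z n) {h \<in> topspace (Z n). h i \<in> {f \<in> carrier G. d (f b) (p i b) < e}}"
      if "i \<le> n" "b \<in> B" for i b
      using that B(3) p(1) iso_closed
      by (intro openin_continuous_map_preimage[of _ T] continuous_map_product_projection openin_Iso_ball) auto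
    then have "openin (Z n) (\<Inter>(i, b)\<in>{..n} \<times> B.
        {h \<in> topspace (Z n). h i \<in> {f \<in> carrier G. d (f b) (p i b) < e}})"
      using B(1,2) by (intro openin_INT2) auto
    moreover have "U' = (\<Inter>(i, b)\<in>{..n} \<times> B.
        {h \<in> topspace (Z n). h i \<in> {f \<in> carrier G. d (f b) (p i b) < e}})"
      unfolding U'_def topspace_Z using B(2) by (auto simp: PiE_def Pi_def)
    ultimately show ?thesis by simp
  qed
  moreover have "restrict p {..n} \<in> U'"
    unfolding U'_def topspace_Z using p(1) iso_closed B(3) e0 by (auto simp: subset_iff)
  moreover have "U' \<subseteq> U"
  proof
    fix h assume h: "h \<in> U'"
    then have hZ: "h \<in> topspace (Z n)" unfolding U'_def by blast
    have "d (h i a) (g i a) < t1" if i: "i \<le> n" and a: "a \<in> A1" for i a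
    proof -
      have hG: "h i \<in> carrier G" using hZ i unfolding topspace_Z by auto
      obtain b where b: "b \<in> B" "d a b \<le> e" using near a by blast
      have X: "a \<in> X" "b \<in> X" using a 1(2) b(1) B(3) by auto
      note X' = iso_closed[OF hG X(1)] iso_closed[OF hG X(2)] iso_closed[OF p(1)[OF i] X(1)]
        iso_closed[OF p(1)[OF i] X(2)] iso_closed[OF gG[OF i] X(1)]
      have 1: "d (h i a) (h i b) \<le> e" using iso_dist[OF hG X] b by simp
      have 2: "d (h i b) (p i b) \<le> e" using h i b(1) unfolding U'_def by (auto intro: less_imp_le)
      have 3: "d (p i b) (p i a) \<le> e" using iso_dist[OF p(1)[OF i] X(2,1)] b commute[of a b] by simp
      have 4: "d (p i a) (g i a) \<le> e" using p(3)[OF i] a by blast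
      \<comment> \<open>Passing through \<open>h i b\<close>, \<open>p i b\<close> and
        \<open>p i a\<close> takes four steps of size at most \<open>e\<close>, which do not add up
        in an ultrametric.\<close>
      have "d (h i a) (g i a) \<le> e"
        by (rule ultra_le[OF X'(1,3,5) ultra_le[OF X'(1,4,3) ultra_le[OF X'(1,2,4) 1 2] 3] 4])
      then show ?thesis using e(2) by simp
    qed
    then show "h \<in> U" using 1(4)[OF hZ] by blast
  qed
  moreover have "\<exists>v\<in>V. \<exists>z\<in>W1. conj_act n v z \<in> W2"
    if W: "openin (Z n) W1" "W1 \<noteq> {}" "W1 \<subseteq> U'" "openin (Z n) W2" "W2 \<noteq> {}" "W2 \<subseteq> U'" for W1 W2
  proof -
    obtain h1 h2 where h: "h1 \<in> W1" "h2 \<in> W2" using W by auto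
    then have "h1 \<in> U'" "h2 \<in> U'" using W by auto
    then have close: "d (h1 i b) (p i b) \<le> e" "d (h2 i b) (p i b) \<le> e" if "i \<le> n" "b \<in> B" for i b
      using that unfolding U'_def by (auto intro: less_imp_le)
    obtain w where w: "w \<in> carrier G" "\<And>b. b \<in> B \<Longrightarrow> d (w b) b \<le> e"
      "\<exists>z\<in>W1. conj_act n (inv\<^bsub>G\<^esub> w) z \<in> W2"
      using conj_connects[OF W(1) h(1) W(4) h(2) B e(1) p(2) close] by blast
    have "inv\<^bsub>G\<^esub> w \<in> V"
    proof (rule 2(4))
      show "inv\<^bsub>G\<^esub> w \<in> carrier G" using w(1) by simp
      show "\<forall>a\<in>A2. d ((inv\<^bsub>G\<^esub> w) a) (\<one>\<^bsub>G\<^esub> a) < t2"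
      proof
        fix a assume a: "a \<in> A2"
        then obtain b where b: "b \<in> B" "d a b \<le> e" using near by blast
        have X: "a \<in> X" "b \<in> X" using a 2(2) b(1) B(3) by auto
        note X' = iso_closed[OF w(1) X(1)] iso_closed[OF w(1) X(2)]
        have 1: "d (w a) (w b) \<le> e" using iso_dist[OF w(1) X] b by simp
        have 2: "d b a \<le> e" using b commute[of a b] by simp
        have "d (w a) a \<le> e"
          by (rule ultra_le[OF X'(1) X(2,1) ultra_le[OF X' X(2) 1 w(2)[OF b(1)]] 2])
        \<comment> \<open>The connecting element is the inverse of \<open>w\<close>; it moves
          \<open>a\<close> exactly as far as \<open>w\<close> does.\<close>
        moreover have "d (w ((inv\<^bsub>G\<^esub> w) a)) (w a) = d ((inv\<^bsub>G\<^esub> w) a) a"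
          by (rule iso_dist) (use w(1) X iso_closed in auto)
        ultimately have "d ((inv\<^bsub>G\<^esub> w) a) a \<le> e" using w(1) X commute[of a "w a"] by simp
        then show "d ((inv\<^bsub>G\<^esub> w) a) (\<one>\<^bsub>G\<^esub> a) < t2" using e(2) X by simp
      qed
    qed
    then show ?thesis using w(3) by blast
  qed
  ultimately show ?thesis by (intro exI[of _ U']) auto
qed

lemma ample_generics_Iso: "ample_generics G T"
  unfolding ample_generics_def
proof
  fix n
  have "metrizable_space (Z n)"
    using completely_metrizable_imp_metrizable_space[OF completely_metrizable_Iso]
    by (auto simp: metrizable_space_product_topology intro: countable_finite)
  \<comment> \<open>The action criterion is formulated for a metric on the space acted on; any
    metric inducing the product topology serves.\<close>
  then obtain M dZ where M: "Metric_space M dZ" "Z n = Metric_space.mtopology M dZ"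
    unfolding metrizable_space_def by blast
  interpret M: Metric_space M dZ by (rule M(1))
  have M_eq: "M = {..n} \<rightarrow>\<^sub>E carrier G" using M(2) topspace_Z M.topspace_mtopology by metis
  have comp: "x i \<in> carrier G" if "x \<in> M" "i \<le> n" for x i using that unfolding M_eq by auto
  interpret polish_action M dZ G T "conj_act n"
  proof (unfold_locales, unfold M(2)[symmetric])
    show "topological_group G T" by (rule topological_group_Iso)
    show "completely_metrizable_space T" by (rule completely_metrizable_Iso)
    show "second_countable (Z n)"
      by (rule second_countable_product_topology) (auto simp: second_countable_Iso)
    show act: "conj_act n g z \<in> M" if "g \<in> carrier G" "z \<in> M" for g z
      using that unfolding M_eq conj_act_def by auto
    show "conj_act n \<one>\<^bsub>G\<^esub> z = z" if "z \<in> M" for z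
      using that comp[OF that] unfolding M_eq conj_act_def
      by (intro extensionalityI[of _ "{..n}"]) (auto simp: PiE_def)
    show "conj_act n (g \<otimes>\<^bsub>G\<^esub> h) z = conj_act n g (conj_act n h z)"
      if "g \<in> carrier G" "h \<in> carrier G" "z \<in> M" for g h z
      using that comp[OF that(3)] unfolding conj_act_def
      by (intro restrict_ext) (simp add: G.inv_mult_group G.m_assoc)
    show "continuous_map (Z n) (Z n) (conj_act n g)" if "g \<in> carrier G" for g
      unfolding continuous_map_componentwise using that
      by (auto simp: conj_act_def topspace_Iso
          intro!: continuous_map_mult[OF topological_group_Iso] continuous_map_product_projection)
    show "continuous_map T (Z n) (\<lambda>g. conj_act n g z)" if "z \<in> M" for z
      unfolding continuous_map_componentwise using comp[OF that]
      by (auto simp: conj_act_def topspace_Iso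
          intro!: continuous_map_mult[OF topological_group_Iso] continuous_map_inv[OF topological_group_Iso])
  qed
  have "(\<lambda>i\<in>{..n}. \<one>\<^bsub>G\<^esub>) \<in> M" unfolding M_eq by auto
  then have "\<exists>z\<in>M. comeager_in M.mtopology ((\<lambda>g. conj_act n g z) ` carrier G)"
    by (intro comeager_orbit) (fold M(2), use conj_transitive conj_local in auto)
  then show "\<exists>x\<in>{..n} \<rightarrow>\<^sub>E carrier G. comeager_in (Z n) (conj_orbit G n x)"
    unfolding M(2) M_eq conj_orbit_def conj_act_def .
qed

end

theorem corollary6p3:
  fixes R :: "real set"
  defines "R \<equiv> {q \<in> \<rat>. q > 0}"
  shows "(\<exists>(G :: ((real \<Rightarrow> nat) \<Rightarrow> (real \<Rightarrow> nat)) monoid) T.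
            polish_group G T \<and> ample_generics G T \<and> countable_cofinality G) \<and>
         (polish_group (Iso (urysohn R) (urysohn_dist R)) (Iso_topology (urysohn R) (urysohn_dist R)) \<and>
          ample_generics (Iso (urysohn R) (urysohn_dist R)) (Iso_topology (urysohn R) (urysohn_dist R)) \<and>
          countable_cofinality (Iso (urysohn R) (urysohn_dist R)))"
proof -
  interpret urysohn_space R
  proof
    show "R \<subseteq> {0<..}" unfolding R_def by auto
    show "countable R" unfolding R_def by (rule countable_subset[OF _ countable_rat]) auto
    show "\<exists>r\<in>R. t \<le> r" for t
    proof -
      obtain k :: nat where "t \<le> real k" using real_arch_simple by blast
      \<comment> \<open>\<open>Suc k\<close> rather than \<open>k\<close>, as \<open>k\<close> may
        be \<open>0\<close> and members of \<open>R\<close> are positive.\<close>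
      then show ?thesis unfolding R_def by (intro bexI[of _ "real (Suc k)"]) auto
    qed
    show "\<exists>r\<in>R. r < e" if "e > 0" for e
      using Rats_dense_in_real[OF that] unfolding R_def by auto
  qed
  show ?thesis
    using polish_group_Iso ample_generics_Iso countable_cofinality_Iso by blast
qed

end
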